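(* There exists a deterministic algorithm which, given the prime number factorisation $n = p_1^{\alpha_1}\cdots p_s^{\alpha_s}$ of an integer $n \ge 2$, constructs the set $\Psi(n)$ in time $$T(n) \le \left(\#\Psi^*(n) + \tau(n) + \log n\right)^{O(1)},$$ where $\Psi^*(n) = \bigcup_{d \mid n} \Psi(d)$.
   Context: $\varphi$ denotes the Euler totient function, $\varphi(m) = \#(\mathbb{Z}/m\mathbb{Z})^\times$. For an integer $n \ge 1$, $\Psi(n)$ denotes the set of all integers $m \ge 1$ with $\varphi(m) = n$. The union defining $\Psi^*(n)$ is over the positive divisors $d$ of $n$. $\tau(n)$ denotes the number of positive divisors of $n$. The implied constant in $O(1)$ is absolute. *)

theory Defs
  imports Complex_Main "HOL-Number_Theory.Totient" "HOL-Library.Log_Nat"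
begin

definition Psi :: "nat \<Rightarrow> nat set" where
  "Psi n = {m. m \<ge> 1 \<and> totient m = n}"

definition Psi_star :: "nat \<Rightarrow> nat set" where
  "Psi_star n = (\<Union>d\<in>{d. d dvd n}. Psi d)"

definition tau :: "nat \<Rightarrow> nat" where
  "tau n = card {d. d dvd n}"

definition is_prime_factorisation :: "nat \<Rightarrow> (nat \<times> nat) list \<Rightarrow> bool" where
  "is_prime_factorisation n fs \<longleftrightarrow>
     distinct (map fst fs) \<and>
     (\<forall>(p, a)\<in>set fs. prime p \<and> a \<ge> 1) \<and>
     n = (\<Prod>(p, a)\<leftarrow>fs. p ^ a)"

text \<open>
  Algorithms are while-programs over a random access memory whose cells hold natural numbers of
  arbitrary size. The memory is a family of named arrays; a program mentions only finitely many
  names, so these can be interleaved into a single memory. Indices may be computed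
  (indirect addressing). Subtraction is truncated and division by zero yields zero.

  Every number that occurs during a run, be it an address or a value, is charged its
  length in binary, in addition to one unit per executed step. This is the usual logarithmic
  cost criterion; running times in this model and on Turing machines differ at most polynomially.
\<close>

type_synonym vname = string
type_synonym state = "vname \<Rightarrow> nat \<Rightarrow> nat"

datatype aexp =
    Const nat
  | Cell vname aexp
  | Plus aexp aexp
  | Minus aexp aexp
  | Times aexp aexp
  | Quot aexp aexp

datatype com =
    Skip
  | Assign vname aexp aexp  \<comment> \<open>array name, index, new value\<close>
  | Seq com com
  | Cond aexp com com  \<comment> \<open>a test succeeds iff the value is nonzero\<close>
  | While aexp com

primrec aval :: "aexp \<Rightarrow> state \<Rightarrow> nat" where
  "aval (Const c) s = c"
| "aval (Cell x e) s = s x (aval e s)"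
| "aval (Plus e1 e2) s = aval e1 s + aval e2 s"
| "aval (Minus e1 e2) s = aval e1 s - aval e2 s"
| "aval (Times e1 e2) s = aval e1 s * aval e2 s"
| "aval (Quot e1 e2) s = aval e1 s div aval e2 s"

text \<open>\<open>floorlog 2 v\<close> is the number of binary digits of \<open>v\<close> (and \<open>0\<close> for \<open>v = 0\<close>).\<close>

definition bit_cost :: "nat \<Rightarrow> nat" where
  "bit_cost v = 1 + floorlog 2 v"

primrec acost :: "aexp \<Rightarrow> state \<Rightarrow> nat" where
  "acost (Const c) s = bit_cost c"
| "acost (Cell x e) s = acost e s + bit_cost (aval (Cell x e) s)"
| "acost (Plus e1 e2) s = acost e1 s + acost e2 s + bit_cost (aval (Plus e1 e2) s)"
| "acost (Minus e1 e2) s = acost e1 s + acost e2 s + bit_cost (aval (Minus e1 e2) s)"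
| "acost (Times e1 e2) s = acost e1 s + acost e2 s + bit_cost (aval (Times e1 e2) s)"
| "acost (Quot e1 e2) s = acost e1 s + acost e2 s + bit_cost (aval (Quot e1 e2) s)"

text \<open>\<open>exec c s t s'\<close>: started in state \<open>s\<close>, the program \<open>c\<close> halts in state \<open>s'\<close> after time \<open>t\<close>.\<close>

inductive exec :: "com \<Rightarrow> state \<Rightarrow> nat \<Rightarrow> state \<Rightarrow> bool" where
  Skip: "exec Skip s 1 s"
| Assign: "exec (Assign x i e) s (1 + acost i s + acost e s)
             (s(x := (s x)(aval i s := aval e s)))"
| Seq: "exec c1 s t1 s' \<Longrightarrow> exec c2 s' t2 s'' \<Longrightarrow> exec (Seq c1 c2) s (t1 + t2) s''"
| CondTrue: "aval b s \<noteq> 0 \<Longrightarrow> exec c1 s t s' \<Longrightarrow> exec (Cond b c1 c2) s (1 + acost b s + t) s'"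
| CondFalse: "aval b s = 0 \<Longrightarrow> exec c2 s t s' \<Longrightarrow> exec (Cond b c1 c2) s (1 + acost b s + t) s'"
| WhileFalse: "aval b s = 0 \<Longrightarrow> exec (While b c) s (1 + acost b s) s"
| WhileTrue: "aval b s \<noteq> 0 \<Longrightarrow> exec c s t1 s' \<Longrightarrow> exec (While b c) s' t2 s'' \<Longrightarrow>
                exec (While b c) s (1 + acost b s + t1 + t2) s''"

inductive_cases SkipE: "exec Skip s t s'"
inductive_cases AssignE: "exec (Assign x i e) s t s'"
inductive_cases SeqE: "exec (Seq c1 c2) s t s'"
inductive_cases CondE: "exec (Cond b c1 c2) s t s'"
inductive_cases WhileE: "exec (While b c) s t s'"

lemma exec_deterministic:
  "exec c s t s' \<Longrightarrow> exec c s u s'' \<Longrightarrow> u = t \<and> s'' = s'"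
proof (induction arbitrary: u s'' rule: exec.induct)
  case (Skip s)
  then show ?case by (rule SkipE) simp
next
  case (Assign x i e s)
  then show ?case by (rule AssignE) simp
next
  case (Seq c1 s t1 s1 c2 t2 s2)
  from Seq.prems obtain u1 r u2 where "u = u1 + u2" "exec c1 s u1 r" "exec c2 r u2 s''"
    by (rule SeqE)
  with Seq.IH show ?case by metis
next
  case (CondTrue b s c1 t s1 c2)
  obtain v where "u = 1 + acost b s + v" "exec c1 s v s''"
    by (rule CondE[OF CondTrue.prems]) (use CondTrue.hyps(1) in auto)
  with CondTrue.IH show ?case by metis
next
  case (CondFalse b s c2 t s1 c1)
  obtain v where "u = 1 + acost b s + v" "exec c2 s v s''"
    by (rule CondE[OF CondFalse.prems]) (use CondFalse.hyps(1) in auto)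
  with CondFalse.IH show ?case by metis
next
  case (WhileFalse b s c)
  show ?case by (rule WhileE[OF WhileFalse.prems]) (use WhileFalse.hyps in auto)
next
  case (WhileTrue b s c t1 s1 t2 s2)
  obtain u1 r u2 where
    "u = 1 + acost b s + u1 + u2" "exec c s u1 r" "exec (While b c) r u2 s''"
    by (rule WhileE[OF WhileTrue.prems]) (use WhileTrue.hyps(1) in auto)
  with WhileTrue.IH show ?case by metis
qed

text \<open>
  The number of pairs is stored in \<open>s[0]\<close>, the primes in the array \<open>p\<close>, the exponents in
  the array \<open>a\<close>. All other cells are initially zero.
\<close>

definition input_state :: "(nat \<times> nat) list \<Rightarrow> state" where
  "input_state fs = (\<lambda>_ _. 0)
     (''s'' := (\<lambda>_. 0)(0 := length fs),
      ''p'' := (\<lambda>i. if i < length fs then fst (fs ! i) else 0),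
      ''a'' := (\<lambda>i. if i < length fs then snd (fs ! i) else 0))"

text \<open>The output is the list of the first \<open>k[0]\<close> entries of the array \<open>m\<close>.\<close>

definition output_list :: "state \<Rightarrow> nat list" where
  "output_list st = map (st ''m'') [0..<st ''k'' 0]"

end

theory Submission
  imports Defs "HOL-Number_Theory.Number_Theory"
begin

text \<open>
  If \<open>p\<close> divides \<open>m\<close> and \<open>\<phi>(m)\<close> divides \<open>n\<close>, then \<open>p - 1\<close> divides \<open>n\<close>. So one lists the divisors \<open>d\<close> of \<open>n\<close>,
  keeps those for which \<open>d + 1\<close> is prime, and builds \<open>\<Psi>\<^sup>*(n)\<close> by adjoining the powers of one such
  prime at a time; every intermediate list is contained in \<open>\<Psi>\<^sup>*(n)\<close>, which bounds the work.

  The primality of \<open>N = d + 1\<close> must be decided in time polynomial in \<open>log N\<close> and \<open>\<tau>(d)\<close>. This uses the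
  idea of Fellows and Koblitz: \<open>N\<close> is prime iff for every \<open>e\<close> dividing \<open>d\<close> with \<open>(e + 1)\<^sup>2 \<le> N\<close> there is
  some \<open>a\<close>, polynomially bounded in \<open>log N\<close>, such that \<open>a\<close> and \<open>a\<^sup>e - 1\<close> both satisfy Fermat's congruence
  modulo \<open>N\<close>. If \<open>r \<le> \<surd>N\<close> is a prime factor of \<open>N\<close>, no \<open>a\<close> works for \<open>e = gcd(r - 1, d)\<close>, since
  \<open>r\<close> divides \<open>a\<^sup>e - 1\<close>. If \<open>N\<close> is prime and all small \<open>a\<close> satisfied \<open>a\<^sup>e = 1\<close>, then so would all smooth
  numbers below \<open>N\<close>; by Chebyshev's lower bound for the number of primes these are more than
  \<open>\<surd>N > e\<close>, too many roots of \<open>X\<^sup>e - 1\<close>.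
\<close>

subsection \<open>Chebyshev's lower bound and the primality criterion\<close>

text \<open>The products \<open>m * (n choose m)\<close> are the denominators of Leibniz's harmonic
  triangle, where an entry of column \<open>m + 1\<close> is a difference of two entries of column
  \<open>m\<close>, from rows \<open>n - 1\<close> and \<open>n\<close>. Dividing the lcm by the new
  denominator therefore gives a difference of two integers already known.\<close>

lemma mult_binomial_dvd_Lcm:
  fixes m n :: nat
  assumes "1 \<le> m" "m \<le> n"
  shows "m * (n choose m) dvd Lcm {1..n}"
  using assms
proof (induction m arbitrary: n rule: nat_induct_at_least)
  case base
  then show ?case by (auto intro: dvd_Lcm)
next
  case (Suc m)
  then obtain k where n: "n = Suc k" by (cases n) auto
  let ?L = "Lcm {1..n}"
  have mk: "m \<le> k" using Suc n by simp
  define f where "f = m * (k choose m)"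
  define g where "g = m * (n choose m)"
  define h where "h = Suc m * (n choose Suc m)"
  have f1: "f dvd Lcm {1..k}" using Suc mk by (simp add: f_def)
  have f2: "Lcm {1..k} dvd ?L" using n by (intro Lcm_subset) auto
  have fL: "f dvd ?L" using f1 f2 by (rule dvd_trans)
  have gL: "g dvd ?L" using Suc by (simp add: g_def)
  have pos: "f > 0" "g > 0" "h > 0" using Suc mk n by (auto simp: f_def g_def h_def)
  text \<open>Leibniz's harmonic triangle: \<open>1/h = 1/f - 1/g\<close>.\<close>
  have e1: "h = n * (k choose m)" unfolding h_def n by (rule Suc_times_binomial)
  have e2: "(n - m) * (n choose m) = n * (k choose m)"
    using binomial_absorb_comp[of n m] unfolding n by simp
  have e3: "h * g = f * h + f * g"
  proof -
    have a: "h = (n - m) * (n choose m)" using e1 e2 by simp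
    have "f * h + f * g = f * ((n - m) * (n choose m) + m * (n choose m))"
      using a by (simp add: g_def algebra_simps)
    also have "\<dots> = f * (n * (n choose m))"
      using Suc by (simp flip: add_mult_distrib)
    also have "\<dots> = g * h" by (simp add: f_def g_def e1 algebra_simps)
    finally show ?thesis by simp
  qed
  obtain u v where u: "?L = f * u" and v: "?L = g * v" using fL gL unfolding dvd_def by blast
  have u': "int ?L = int f * int u" and v': "int ?L = int g * int v" using u v by (metis of_nat_mult)+
  have e3': "int h * int g = int f * int h + int f * int g"
    using arg_cong[OF e3, of int] by simp
  have "int g * (int h * int u) = (int h * int g) * int u" by (simp only: mult_ac)
  also have "\<dots> = (int f * int u) * int h + (int f * int u) * int g"
    unfolding e3' by (simp only: distrib_left distrib_right mult_ac)
  also have "\<dots> = (int g * int v) * int h + ?L * int g" by (simp only: u'[symmetric] v'[symmetric])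
  also have "\<dots> = int g * (int h * int v + ?L)" by (simp only: distrib_left mult_ac)
  finally have "int h * int u = int h * int v + int ?L" using pos by simp
  then have "int ?L = int h * (int u - int v)" by (simp add: algebra_simps)
  then have "int h dvd int ?L" by simp
  then show ?case unfolding h_def by (simp only: int_dvd_int_iff)
qed

text \<open>The lcm divides the product, over the primes \<open>p \<le> n\<close>, of the largest
  power of \<open>p\<close> not exceeding \<open>n\<close>; each of these factors is at most
  \<open>n\<close>.\<close>

lemma Lcm_atLeastAtMost_le:
  fixes n :: nat
  assumes "n \<ge> 1"
  shows "Lcm {1..n} \<le> n ^ card {p. prime p \<and> p \<le> n}"
proof -
  let ?P = "{p. prime p \<and> p \<le> n}"
  define k where "k p = floorlog p n - 1" for p
  have fin: "finite ?P" by simp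
  have ppow: "p ^ k p \<le> n" if "p \<in> ?P" for p
  proof -
    have "p > 1" using that prime_gt_1_nat by auto
    then show ?thesis using assms floorlog_bounds[of n p] by (simp add: k_def)
  qed
  let ?Q = "\<Prod>p\<in>?P. p ^ k p"
  have "i dvd ?Q" if i: "i \<in> {1..n}" for i
  proof (rule multiplicity_le_imp_dvd)
    show "i \<noteq> 0" using i by simp
    fix p :: nat assume p: "prime p"
    show "multiplicity p i \<le> multiplicity p ?Q"
    proof (cases "p \<le> n")
      case True
      have "p ^ multiplicity p i \<le> i" using i by (intro dvd_imp_le multiplicity_dvd) auto
      then have a: "p ^ multiplicity p i \<le> n" using i by simp
      have "n < p ^ Suc (k p)"
        using floorlog_bounds[of n p] assms prime_gt_1_nat[OF p]
        by (auto simp: k_def floorlog_def)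
      with a have "p ^ multiplicity p i < p ^ Suc (k p)" by simp
      then have "multiplicity p i \<le> k p"
        using prime_gt_1_nat[OF p] by (meson less_Suc_eq_le power_less_imp_less_exp)
      also have "k p \<le> multiplicity p ?Q"
      proof (rule multiplicity_geI)
        show "?Q \<noteq> 0" using prime_gt_0_nat by auto
        show "\<not> is_unit p" using p by auto
        show "p ^ k p dvd ?Q" using True p fin by (intro dvd_prod_eqI[of _ p]) auto
      qed
      finally show ?thesis .
    next
      case False
      then have "\<not> p dvd i" using i by (auto dest!: dvd_imp_le)
      then show ?thesis by (simp add: not_dvd_imp_multiplicity_0)
    qed
  qed
  then have "Lcm {1..n} dvd ?Q" by (rule Lcm_least)
  then have "Lcm {1..n} \<le> ?Q"
    by (rule dvd_imp_le) (auto intro!: prod_pos simp: prime_gt_0_nat)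
  also have "\<dots> \<le> (\<Prod>p\<in>?P. n)" using ppow by (intro prod_mono) auto
  finally show ?thesis by simp
qed

text \<open>The \<open>n\<close> terms \<open>k * (n choose k)\<close> sum to
  \<open>n * 2 ^ (n - 1)\<close>, and each is bounded by the lcm because it divides it, so the lcm
  is at least their average.\<close>

lemma two_power_le_power_prime_count:
  fixes n :: nat
  assumes "n \<ge> 1"
  shows "2 ^ (n - 1) \<le> n ^ card {p. prime p \<and> p \<le> n}"
proof -
  have le: "k * (n choose k) \<le> Lcm {1..n}" if "k \<le> n" for k
  proof (cases "k = 0")
    case False
    then show ?thesis using that mult_binomial_dvd_Lcm[of k n]
      by (intro dvd_imp_le) (auto simp: Lcm_0_iff Suc_le_eq intro!: Nat.gr0I)
  qed simp
  have "n * 2 ^ (n - 1) = (\<Sum>k\<le>n. k * (n choose k))" using choose_linear_sum[of n] by simp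
  also have "\<dots> = (\<Sum>k\<in>{1..n}. k * (n choose k))"
    by (intro sum.mono_neutral_right) auto
  also have "\<dots> \<le> (\<Sum>k\<in>{1..n}. Lcm {1..n})" using le by (intro sum_mono) auto
  also have "\<dots> = n * Lcm {1..n}" by simp
  finally have "2 ^ (n - 1) \<le> Lcm {1..n}" using assms by simp
  then show ?thesis using Lcm_atLeastAtMost_le[OF assms] by linarith
qed

text \<open>Chebyshev's bound in the form needed for counting smooth numbers. If it failed, the
  previous bound would give \<open>Q \<le> l * u\<close> with \<open>l\<close> the bit length of
  \<open>B\<close>. But \<open>B ^ u < 2 ^ L\<close> forces \<open>(l - 1) * u < L\<close>, and
  \<open>l \<le> 2 * (l - 1)\<close>, so \<open>l * u < 2 * L = Q\<close>.\<close>

lemma prime_count_gt: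
  assumes Q: "Q \<ge> 2" and B: "B = Q ^ 4" and u: "u \<ge> 1" and up: "B ^ u < 2 ^ L" and QL: "Q = 2 * L"
  shows "u * Q ^ 3 \<le> card {p. prime p \<and> p \<le> B}"
proof (rule ccontr)
  let ?\<pi> = "card {p. prime p \<and> p \<le> B}"
  assume "\<not> u * Q ^ 3 \<le> ?\<pi>"
  then have lt: "?\<pi> \<le> u * Q ^ 3" by simp
  define l where "l = floorlog 2 B"
  have "2 ^ 4 \<le> Q ^ 4" using Q by (intro power_mono) auto
  then have B16: "B \<ge> 16" by (simp add: B)
  then have l: "2 ^ (l - 1) \<le> B" "B < 2 ^ l" using floorlog_bounds[of B 2] by (auto simp: l_def)
  have l2: "l \<ge> 2"
  proof (rule ccontr)
    assume "\<not> l \<ge> 2"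
    then have "(2::nat) ^ l \<le> 2" using power_increasing[of l 1 "2::nat"] by simp
    then show False using l(2) B16 by linarith
  qed
  have "{p. prime p \<and> p \<le> B} \<noteq> {}" using B16 by (auto intro!: exI[of _ 2])
  then have pi1: "?\<pi> \<ge> 1" by (simp add: Suc_le_eq card_gt_0_iff)
  have "2 ^ (B - 1) \<le> B ^ ?\<pi>" using B16 by (intro two_power_le_power_prime_count) auto
  also have "\<dots> < (2 ^ l) ^ ?\<pi>" using l pi1 by (intro power_strict_mono) auto
  finally have "(2::nat) ^ (B - 1) < 2 ^ (l * ?\<pi>)" by (simp add: power_mult)
  then have "B - 1 < l * ?\<pi>" by (rule power_less_imp_less_exp[rotated]) simp
  then have "B \<le> l * ?\<pi>" by linarith
  also have "\<dots> \<le> l * (u * Q ^ 3)" using lt by simp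
  finally have "B \<le> l * (u * Q ^ 3)" .
  moreover have "B = Q ^ 3 * Q" by (simp add: B power4_eq_xxxx power3_eq_cube)
  moreover have "l * (u * Q ^ 3) = Q ^ 3 * (l * u)" by simp
  ultimately have "Q ^ 3 * Q \<le> Q ^ 3 * (l * u)" by simp
  then have a: "Q \<le> l * u" using Q unfolding mult_le_cancel1 by simp
  have "(2 ^ (l - 1)) ^ u \<le> B ^ u" using l by (intro power_mono) auto
  also have "\<dots> < 2 ^ L" using up .
  finally have "(2::nat) ^ ((l - 1) * u) < 2 ^ L" by (simp add: power_mult)
  then have b: "(l - 1) * u < L" by (rule power_less_imp_less_exp[rotated]) simp
  have "l * u \<le> (2 * (l - 1)) * u" using l2 by (intro mult_right_mono) auto
  then show False using a b QL by linarith
qed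

section \<open>Smooth numbers and small nonroots modulo a prime\<close>

lemma inj_on_prod_primes:
  assumes "\<And>p. p \<in> P \<Longrightarrow> prime (p :: nat)" "finite P"
  shows "inj_on (\<Prod>) {A. A \<subseteq> P}"
proof (rule inj_onI)
  fix A A' assume *: "A \<in> {A. A \<subseteq> P}" "A' \<in> {A. A \<subseteq> P}" "\<Prod>A = \<Prod>A'"
  have pf: "{p. prime p \<and> p dvd \<Prod>X} = X" if "X \<subseteq> P" for X
  proof -
    have fX: "finite X" using that assms(2) finite_subset by blast
    show ?thesis
    proof (intro equalityI subsetI)
      fix p assume "p \<in> {p. prime p \<and> p dvd \<Prod>X}"
      then have p: "prime p" "p dvd \<Prod>X" by auto
      then obtain q where q: "q \<in> X" "p dvd q" using prime_dvd_prod_iff[OF fX p(1), of "\<lambda>x. x"] by auto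
      then have "prime q" using that assms by auto
      then show "p \<in> X" using q p primes_dvd_imp_eq by blast
    next
      fix p assume "p \<in> X"
      then show "p \<in> {p. prime p \<and> p dvd \<Prod>X}" using that assms fX by (auto intro: dvd_prodI)
    qed
  qed
  have "A = {p. prime p \<and> p dvd \<Prod>A}" using * by (intro pf[symmetric]) auto
  also have "\<dots> = {p. prime p \<and> p dvd \<Prod>A'}" by (simp only: *(3))
  also have "\<dots> = A'" using * by (intro pf) auto
  finally show "A = A'" .
qed

text \<open>If every small \<open>a\<close> were a root of \<open>X^e - 1\<close>, so would be every
  product of \<open>u\<close> distinct primes up to \<open>B\<close>, where
  \<open>B ^ u < p \<le> B ^ Suc u\<close>. These products are distinct and below \<open>p\<close>,
  and there are about \<open>B^(3u/4)\<close> of them or more, while \<open>e\<close> is below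
  \<open>B^((u+1)/2)\<close>.\<close>

lemma exists_small_nonroot:
  fixes p e L :: nat
  assumes p: "prime p" and e: "e \<ge> 1" "(e + 1)\<^sup>2 \<le> p" and L: "p \<le> 2 ^ L" "L \<ge> 1"
    and B: "B = (2 * L) ^ 4"
  shows "\<exists>a\<in>{2..B}. a < p \<and> \<not> [a ^ e = 1] (mod p)"
proof (rule ccontr)
  assume "\<not> ?thesis"
  then have no: "[a ^ e = 1] (mod p)" if "a \<in> {2..B}" "a < p" for a using that by blast
  define G where "G = {x\<in>{..<p}. [x ^ e = 1] (mod p)}"
  have finG: "finite G" by (simp add: G_def)
  have cG: "card G \<le> e" unfolding G_def using p e by (intro roots_mod_prime_bound) auto
  have small: "a \<in> G" if "1 \<le> a" "a \<le> B" "a < p" for a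
    using no[of a] that by (cases "a = 1") (auto simp: G_def)
  have ep: "e < p - 1"
  proof -
    have "(e + 1)\<^sup>2 = e * e + 2 * e + 1" by (simp add: power2_eq_square)
    then show ?thesis using e by linarith
  qed
  show False
  proof (cases "p \<le> B\<^sup>2")
    \<comment> \<open>For \<open>p\<close> this small no products are needed: the numbers up to
      \<open>min B (p - 1)\<close> themselves exceed \<open>e\<close> in number, since
      \<open>e + 1\<close> is at most the square root of \<open>p\<close>.\<close>
    case True
    have "{1..min B (p - 1)} \<subseteq> G" using small by auto
    from card_mono[OF finG this] have "min B (p - 1) \<le> e" using cG by simp
    then have "B \<le> e" using ep by linarith
    then have "B\<^sup>2 < (e + 1)\<^sup>2" by (intro power_strict_mono) auto
    then show False using True e by linarith
  next
    case False
    have L1: "(2::nat) ^ 4 \<le> (2 * L) ^ 4" using L by (intro power_mono) auto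
    then have B16: "B \<ge> 16" using B by simp
    have "\<exists>u. B ^ u < p \<and> p \<le> B ^ Suc u"
    proof -
      have ex: "\<exists>v. p \<le> B ^ v"
      proof
        have "p \<le> 2 ^ p" by (simp add: less_imp_le)
        also have "\<dots> \<le> B ^ p" using B16 by (intro power_mono) auto
        finally show "p \<le> B ^ p" .
      qed
      define v where "v = (LEAST v. p \<le> B ^ v)"
      have "p \<le> B ^ v" unfolding v_def using ex by (rule LeastI_ex)
      moreover have "v \<noteq> 0" using \<open>p \<le> B ^ v\<close> prime_gt_1_nat[OF p] by (intro notI) simp
      then obtain u where u: "v = Suc u" by (cases v) auto
      moreover have "\<not> p \<le> B ^ u" using not_less_Least[of u "\<lambda>v. p \<le> B ^ v"] u by (simp add: v_def)
      ultimately show ?thesis by (intro exI[of _ u]) auto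
    qed
    then obtain u where u: "B ^ u < p" "p \<le> B ^ Suc u" by blast
    \<comment> \<open>This is what \<open>p > B^2\<close> provides, and what the final comparison of
      the exponents \<open>6 * u\<close> and \<open>4 * (u + 1)\<close> of \<open>Q\<close>
      contradicts.\<close>
    have u2: "u \<ge> 2"
    proof (rule ccontr)
      assume "\<not> u \<ge> 2"
      then have "B ^ Suc u \<le> B ^ 2" using B16 by (intro power_increasing) auto
      then show False using u False by linarith
    qed
    define P where "P = {q. prime q \<and> q \<le> B}"
    have finP: "finite P" by (simp add: P_def)
    define \<pi> where "\<pi> = card P"
    define Q where "Q = 2 * L"
    have Q2: "Q \<ge> 2" and BQ: "B = Q ^ 4" using L B by (auto simp: Q_def)
    have pi: "u * Q ^ 3 \<le> \<pi>" unfolding \<pi>_def P_def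
      using u L u2 by (intro prime_count_gt[OF Q2 BQ _ _ Q_def]) auto
    have "u * 1 \<le> u * Q ^ 3" using Q2 by (intro mult_le_mono) auto
    then have upi: "u \<le> \<pi>" using pi by linarith
    let ?S = "{A. A \<subseteq> P \<and> card A = u}"
    have img: "(\<Prod>) ` ?S \<subseteq> G"
    proof
      fix x assume "x \<in> (\<Prod>) ` ?S"
      then obtain A where A: "A \<subseteq> P" "card A = u" "x = \<Prod>A" by auto
      have "\<Prod>A \<le> (\<Prod>q\<in>A. B)" using A by (intro prod_mono) (auto simp: P_def)
      then have xp: "x < p" using A u by simp
      have "B ^ 1 \<le> B ^ u" using u2 B16 by (intro power_increasing) auto
      then have Bp: "B < p" using u by simp
      have "[(\<Prod>q\<in>A. q ^ e) = (\<Prod>q\<in>A. 1)] (mod p)"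
      proof (rule cong_prod)
        fix q assume "q \<in> A"
        then have "prime q" "q \<le> B" using A by (auto simp: P_def)
        then show "[q ^ e = 1] (mod p)" using no[of q] Bp prime_ge_2_nat[of q] by simp
      qed
      then have "[x ^ e = 1] (mod p)" using A by (simp add: prod_power_distrib)
      then show "x \<in> G" using xp by (simp add: G_def)
    qed
    have "inj_on (\<Prod>) ?S"
      using inj_on_prod_primes[OF _ finP] by (rule inj_on_subset) (auto simp: P_def)
    then have "card ?S = card ((\<Prod>) ` ?S)" by (simp add: card_image)
    also have "\<dots> \<le> e" using card_mono[OF finG img] cG by simp
    also have "card ?S = \<pi> choose u" unfolding \<pi>_def using finP by (rule n_subsets)
    finally have ce: "\<pi> choose u \<le> e" .
    \<comment> \<open>The standard estimate \<open>(\<pi> choose u) \<ge> (\<pi> / u)^u\<close>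
      turns the prime count into at least \<open>Q ^ (3 * u)\<close> roots.\<close>
    have "real Q ^ 3 \<le> real \<pi> / real u"
      using pi u2 by (simp add: field_simps flip: of_nat_mult of_nat_power)
    then have "(real Q ^ 3) ^ u \<le> (real \<pi> / real u) ^ u" by (intro power_mono) auto
    also have "\<dots> \<le> real (\<pi> choose u)" using binomial_ge_n_over_k_pow_k[OF upi] by simp
    finally have "real ((Q ^ 3) ^ u) \<le> real (\<pi> choose u)" by simp
    then have "(Q ^ 3) ^ u \<le> \<pi> choose u" by linarith
    then have "(Q ^ 3) ^ u < e + 1" using ce by simp
    then have "((Q ^ 3) ^ u)\<^sup>2 < (e + 1)\<^sup>2" by (intro power_strict_mono) auto
    also have "\<dots> \<le> B ^ Suc u" using e u by linarith
    finally have "Q ^ (3 * u * 2) < Q ^ (4 * Suc u)" by (simp only: BQ flip: power_mult)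
    then have "3 * u * 2 < 4 * Suc u" by (rule power_less_imp_less_exp[rotated]) (use Q2 in linarith)
    then show False using u2 by simp
  qed
qed

text \<open>Modulo \<open>d + 1\<close>, the number \<open>a ^ e + d\<close> is \<open>a ^ e - 1\<close> without truncated subtraction.\<close>

lemma prime_criterion:
  fixes d L :: nat
  assumes d: "d \<ge> 1" and L: "d + 1 \<le> 2 ^ L" and B: "B = (2 * L) ^ 4"
  shows "prime (d + 1) \<longleftrightarrow>
    (\<forall>e. e dvd d \<longrightarrow> (e + 1)\<^sup>2 \<le> d + 1 \<longrightarrow>
      (\<exists>a\<in>{2..B}. [a ^ d = 1] (mod (d + 1)) \<and> [(a ^ e + d) ^ d = 1] (mod (d + 1))))"
    (is "_ \<longleftrightarrow> ?R")
proof
  assume p: "prime (d + 1)"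
  show ?R
  proof (intro allI impI)
    fix e assume e: "e dvd d" "(e + 1)\<^sup>2 \<le> d + 1"
    have e1: "e \<ge> 1" using e d by (cases e) auto
    have "L \<ge> 1" using L d by (cases L) auto
    then obtain a where a: "a \<in> {2..B}" "a < d + 1" "\<not> [a ^ e = 1] (mod (d + 1))"
      using exists_small_nonroot[OF p e1 e(2) L _ B] by blast
    \<comment> \<open>Both congruences are instances of Fermat's theorem; the second applies because
      \<open>a ^ e\<close> is not 1 modulo the prime, so \<open>a ^ e + d\<close> is not divisible
      by it.\<close>
    have fermat: "[x ^ d = 1] (mod (d + 1))" if "\<not> d + 1 dvd x" for x
      using fermat_theorem[OF p, of x] that by simp
    have "\<not> d + 1 dvd a" using a by (auto dest: dvd_imp_le)
    moreover have "\<not> d + 1 dvd a ^ e + d"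
    proof
      assume "d + 1 dvd a ^ e + d"
      then have "[a ^ e + d = 1 + d] (mod (d + 1))" by (simp add: cong_def mod_eq_0_iff_dvd)
      then show False using a cong_add_rcancel_nat by blast
    qed
    ultimately show "\<exists>a\<in>{2..B}. [a ^ d = 1] (mod (d + 1)) \<and> [(a ^ e + d) ^ d = 1] (mod (d + 1))"
      using a fermat by blast
  qed
next
  assume R: ?R
  show "prime (d + 1)"
  proof (rule ccontr)
    assume np: "\<not> prime (d + 1)"
    obtain r where r: "prime r" "r dvd d + 1" "r\<^sup>2 \<le> d + 1"
    proof -
      obtain q where q: "prime q" "q dvd d + 1" "\<forall>q'. prime q' \<and> q' dvd d + 1 \<longrightarrow> q \<le> q'"
        using ex_has_least_nat[of "\<lambda>q. prime q \<and> q dvd d + 1" _ "\<lambda>q. q"] prime_factor_nat[of "d+1"] d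
        by auto
      obtain w where w: "d + 1 = q * w" using q by (auto elim: dvdE)
      have "w \<noteq> 1" using w q np by auto
      then obtain q' where q': "prime q'" "q' dvd w" using prime_factor_nat by blast
      then have "q \<le> q'" using q w by auto
      also have "q' \<le> w" using q' w by (intro dvd_imp_le) (auto intro: Nat.gr0I)
      finally have "q\<^sup>2 \<le> d + 1" using w by (simp add: power2_eq_square)
      then show ?thesis using that q by blast
    qed
    \<comment> \<open>The order of \<open>a\<close> modulo \<open>r\<close> divides
      \<open>r - 1\<close> by Fermat and \<open>d\<close> by the first congruence, hence
      \<open>e\<close>. Then \<open>a ^ e + d\<close> is congruent to \<open>1 + d\<close>, that is
      to 0, modulo \<open>r\<close>, against the second congruence.\<close>
    define e where "e = gcd (r - 1) d"
    have r2: "r \<ge> 2" using r prime_ge_2_nat by blast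
    have "e \<le> r - 1" unfolding e_def using r2 by (intro gcd_le1_nat) auto
    then have "(e + 1)\<^sup>2 \<le> r\<^sup>2" using r2 by (intro power_mono) auto
    then have "(e + 1)\<^sup>2 \<le> d + 1" using r by linarith
    then obtain a where a: "[a ^ d = 1] (mod (d + 1))" "[(a ^ e + d) ^ d = 1] (mod (d + 1))"
      using R by (auto simp: e_def)
    have ar: "[a ^ d = 1] (mod r)" "[(a ^ e + d) ^ d = 1] (mod r)"
      using a r cong_dvd_modulus_nat by blast+
    have nra: "\<not> r dvd a"
    proof
      assume "r dvd a"
      then have "r dvd a ^ d" using d dvd_power_le[of r a 1 d] by simp
      then have "r dvd 1" using ar(1) cong_dvd_iff by blast
      then show False using r2 by simp
    qed
    then have "[a ^ (r - 1) = 1] (mod r)" using fermat_theorem[OF r(1)] by blast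
    then have "ord r a dvd r - 1" "ord r a dvd d" using ar ord_divides by blast+
    then have "ord r a dvd e" by (simp add: e_def)
    then have "[a ^ e = 1] (mod r)" using ord_divides by blast
    then have "[a ^ e + d = 1 + d] (mod r)" by (intro cong_add) auto
    then have "r dvd a ^ e + d" using r(2) cong_dvd_iff[of "a ^ e + d" "1 + d" r] by (simp add: add.commute)
    then have "r dvd (a ^ e + d) ^ d" using d dvd_power_le[of r "a ^ e + d" 1 d] by simp
    then have "r dvd 1" using ar(2) cong_dvd_iff by blast
    then show False using r2 by simp
  qed
qed

subsection \<open>A program logic with running times\<close>

primrec writes :: "com \<Rightarrow> vname set" where
  "writes Skip = {}"
| "writes (Assign x i e) = {x}"
| "writes (Seq c1 c2) = writes c1 \<union> writes c2"
| "writes (Cond b c1 c2) = writes c1 \<union> writes c2"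
| "writes (While b c) = writes c"

lemma exec_frame: "exec c s t s' \<Longrightarrow> x \<notin> writes c \<Longrightarrow> s' x = s x"
  by (induction rule: exec.induct) auto

text \<open>A constant counts with its value, so that \<open>aval_le_power\<close> needs no side condition.\<close>

primrec asize :: "aexp \<Rightarrow> nat" where
  "asize (Const c) = Suc c"
| "asize (Cell x e) = Suc (asize e)"
| "asize (Plus e1 e2) = Suc (asize e1 + asize e2)"
| "asize (Minus e1 e2) = Suc (asize e1 + asize e2)"
| "asize (Times e1 e2) = Suc (asize e1 + asize e2)"
| "asize (Quot e1 e2) = Suc (asize e1 + asize e2)"

definition bounded :: "nat \<Rightarrow> state \<Rightarrow> bool" where
  "bounded M s \<longleftrightarrow> (\<forall>x i. s x i \<le> M)"

lemma boundedD: "bounded M s \<Longrightarrow> s x i \<le> M"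
  by (simp add: bounded_def)

text \<open>One more factor \<open>M\<close> per node is enough: in a sum it absorbs the factor 2,
  in a product the exponents simply add.\<close>

lemma aval_le_power:
  assumes "bounded M s" "M \<ge> 2"
  shows "aval e s \<le> M ^ asize e"
proof (induction e)
  case (Const c)
  have "c \<le> 2 ^ Suc c" using less_exp[of c] unfolding power_Suc by linarith
  also have "\<dots> \<le> M ^ Suc c" using assms by (intro power_mono) auto
  finally show ?case by simp
next
  case (Cell x e)
  have "s x (aval e s) \<le> M ^ 1" using assms by (simp add: bounded_def)
  also have "\<dots> \<le> M ^ asize (Cell x e)" using assms by (intro power_increasing) auto
  finally show ?case by simp
next
  case (Plus e1 e2)
  have "M ^ asize e1 \<le> M ^ (asize e1 + asize e2)" "M ^ asize e2 \<le> M ^ (asize e1 + asize e2)"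
    using assms by (auto intro!: power_increasing)
  then have "aval (Plus e1 e2) s \<le> 2 * M ^ (asize e1 + asize e2)" using Plus by simp
  also have "\<dots> \<le> M * M ^ (asize e1 + asize e2)" using assms by (intro mult_right_mono) auto
  finally show ?case by simp
next
  case (Minus e1 e2)
  have "M ^ asize e1 \<le> M ^ asize (Minus e1 e2)" using assms by (intro power_increasing) auto
  then show ?case using Minus by simp
next
  case (Times e1 e2)
  have "aval e1 s * aval e2 s \<le> M ^ asize e1 * M ^ asize e2" using Times by (intro mult_mono) auto
  also have "\<dots> \<le> M ^ asize (Times e1 e2)"
    using assms by (simp add: power_add)
  finally show ?case by simp
next
  case (Quot e1 e2)
  have "aval e1 s div aval e2 s \<le> aval e1 s" by simp
  also have "\<dots> \<le> M ^ asize e1" using Quot by simp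
  also have "M ^ asize e1 \<le> M ^ asize (Quot e1 e2)" using assms by (intro power_increasing) auto
  finally show ?case by simp
qed

lemma floorlog_le_of_less: "m < 2 ^ k \<Longrightarrow> floorlog 2 m \<le> k"
  by (simp add: floorlog_leI)

text \<open>Intermediate values of an expression may exceed \<open>M\<close>, but their length is at
  most \<open>S\<close> times that of \<open>M\<close>.\<close>

lemma bit_cost_aval_le:
  assumes "bounded M s" "M \<ge> 2" "asize e \<le> S"
  shows "bit_cost (aval e s) \<le> 1 + S * floorlog 2 M"
proof -
  have "M < 2 ^ floorlog 2 M" using floorlog_bounds[of M 2] assms by auto
  moreover have pos: "asize e > 0" by (cases e) auto
  ultimately have "M ^ asize e < (2 ^ floorlog 2 M) ^ asize e"
    by (intro power_strict_mono) auto
  then have "aval e s < 2 ^ (floorlog 2 M * asize e)"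
    using aval_le_power[OF assms(1,2), of e] by (simp add: power_mult)
  then have "floorlog 2 (aval e s) \<le> floorlog 2 M * asize e" by (rule floorlog_le_of_less)
  also have "\<dots> \<le> S * floorlog 2 M" using assms(3) by simp
  finally show ?thesis by (simp add: bit_cost_def)
qed

lemma acost_le:
  assumes "bounded M s" "M \<ge> 2"
  shows "asize e \<le> S \<Longrightarrow> acost e s \<le> asize e * (1 + S * floorlog 2 M)"
proof (induction e)
  case (Const c)
  have "bit_cost c \<le> 1 + S * floorlog 2 M" using bit_cost_aval_le[OF assms Const] by simp
  then show ?case by simp
next
  case (Cell x e)
  from bit_cost_aval_le[OF assms Cell.prems] Cell show ?case by (simp add: distrib_right)
next
  case (Plus e1 e2)
  from bit_cost_aval_le[OF assms Plus.prems] Plus show ?case by (simp add: distrib_right)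
next
  case (Minus e1 e2)
  from bit_cost_aval_le[OF assms Minus.prems] Minus show ?case by (simp add: distrib_right)
next
  case (Times e1 e2)
  from bit_cost_aval_le[OF assms Times.prems] Times show ?case by (simp add: distrib_right)
next
  case (Quot e1 e2)
  from bit_cost_aval_le[OF assms Quot.prems] Quot show ?case by (simp add: distrib_right)
qed

text \<open>
  Time is counted in units that pay for one assignment or test whose expressions have size at
  most 40, as long as no memory cell exceeds \<open>M\<close>.
\<close>

definition unit_cost :: "nat \<Rightarrow> nat" where
  "unit_cost M = 1 + 80 * (1 + 40 * floorlog 2 M)"

lemma acost_le_unit:
  assumes "bounded M s" "M \<ge> 2" "asize e \<le> 40"
  shows "acost e s \<le> 40 * (1 + 40 * floorlog 2 M)"
proof -
  have "acost e s \<le> asize e * (1 + 40 * floorlog 2 M)" using acost_le[OF assms] .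
  also have "\<dots> \<le> 40 * (1 + 40 * floorlog 2 M)" using assms by (intro mult_right_mono) auto
  finally show ?thesis .
qed

text \<open>Total correctness with a memory bound. The postcondition receives a number
  \<open>k\<close> of units that bounds the time instead of the exact time, so costs add up along a
  program. Boundedness sits inside the definition on both sides, so the rules need not carry
  it.\<close>

definition wp :: "nat \<Rightarrow> com \<Rightarrow> (nat \<Rightarrow> state \<Rightarrow> bool) \<Rightarrow> state \<Rightarrow> bool" where
  "wp M c Q s \<longleftrightarrow> (M \<ge> 2 \<longrightarrow> bounded M s \<longrightarrow>
     (\<exists>t k s'. exec c s t s' \<and> t \<le> k * unit_cost M \<and> bounded M s' \<and> Q k s'))"

lemma wpI:
  assumes "M \<ge> 2 \<Longrightarrow> bounded M s \<Longrightarrow> \<exists>t k s'. exec c s t s' \<and> t \<le> k * unit_cost M \<and> bounded M s' \<and> Q k s'"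
  shows "wp M c Q s"
  using assms by (simp add: wp_def)

lemma wpE:
  assumes "wp M c Q s" "M \<ge> 2" "bounded M s"
  obtains t k s' where "exec c s t s'" "t \<le> k * unit_cost M" "bounded M s'" "Q k s'"
  using assms by (auto simp: wp_def)

text \<open>The frame property is part of the rule of consequence; a specification then only has to
  mention arrays that its program writes.\<close>

lemma wp_conseq:
  assumes "wp M c R s"
    and "\<And>k s'. R k s' \<Longrightarrow> bounded M s' \<Longrightarrow> (\<And>x. x \<notin> writes c \<Longrightarrow> s' x = s x) \<Longrightarrow> Q k s'"
  shows "wp M c Q s"
proof (rule wpI)
  assume "M \<ge> 2" "bounded M s"
  with assms(1) obtain t k s' where *: "exec c s t s'" "t \<le> k * unit_cost M" "bounded M s'" "R k s'"
    by (rule wpE)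
  then have "Q k s'" using assms(2) exec_frame by blast
  then show "\<exists>t k s'. exec c s t s' \<and> t \<le> k * unit_cost M \<and> bounded M s' \<and> Q k s'"
    using * by blast
qed

text \<open>Makes the bound on the current cells available when a stored value has to be shown to be
  at most \<open>M\<close>.\<close>

lemma wp_bounded: "(M \<ge> 2 \<Longrightarrow> bounded M s \<Longrightarrow> wp M c Q s) \<Longrightarrow> wp M c Q s"
  by (auto simp: wp_def)

lemma wp_Skip: "Q 1 s \<Longrightarrow> wp M Skip Q s"
  by (intro wpI exI[of _ 1] exI[of _ s]) (use exec.Skip[of s] in \<open>auto simp: unit_cost_def\<close>)

text \<open>Only the stored value has to respect \<open>M\<close>; larger intermediate values are
  paid for through the size of the expressions.\<close>

lemma wp_Assign:
  assumes "asize i \<le> 40" "asize e \<le> 40"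
    and "bounded M s \<Longrightarrow> aval e s \<le> M"
    and "Q 1 (s(x := (s x)(aval i s := aval e s)))"
  shows "wp M (Assign x i e) Q s"
proof (rule wpI)
  assume M: "M \<ge> 2" and b: "bounded M s"
  have "1 + acost i s + acost e s \<le> unit_cost M"
    using acost_le_unit[OF b M assms(1)] acost_le_unit[OF b M assms(2)] by (simp add: unit_cost_def)
  moreover have "bounded M (s(x := (s x)(aval i s := aval e s)))"
    using b assms(3) by (auto simp: bounded_def)
  ultimately show "\<exists>t k s'. exec (Assign x i e) s t s' \<and> t \<le> k * unit_cost M \<and> bounded M s' \<and> Q k s'"
    using exec.Assign[of x i e s] assms(4) by (metis mult_1)
qed

lemma wp_Seq:
  assumes "wp M c1 (\<lambda>k1. wp M c2 (\<lambda>k2. Q (k1 + k2))) s"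
  shows "wp M (Seq c1 c2) Q s"
proof (rule wpI)
  assume M: "M \<ge> 2" and b: "bounded M s"
  obtain t1 k1 s1 where 1: "exec c1 s t1 s1" "t1 \<le> k1 * unit_cost M" "bounded M s1"
    "wp M c2 (\<lambda>k2. Q (k1 + k2)) s1"
    using wpE[OF assms M b] by metis
  obtain t2 k2 s2 where 2: "exec c2 s1 t2 s2" "t2 \<le> k2 * unit_cost M" "bounded M s2" "Q (k1 + k2) s2"
    using wpE[OF 1(4) M 1(3)] by metis
  from exec.Seq[OF 1(1) 2(1)] 1 2
  show "\<exists>t k s'. exec (Seq c1 c2) s t s' \<and> t \<le> k * unit_cost M \<and> bounded M s' \<and> Q k s'"
    by (intro exI[of _ "t1 + t2"] exI[of _ "k1 + k2"] exI[of _ s2]) (auto simp: distrib_right)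
qed

lemma wp_Cond:
  assumes "asize b \<le> 40"
    and "aval b s \<noteq> 0 \<Longrightarrow> wp M c1 (\<lambda>k. Q (1 + k)) s" "aval b s = 0 \<Longrightarrow> wp M c2 (\<lambda>k. Q (1 + k)) s"
  shows "wp M (Cond b c1 c2) Q s"
proof (rule wpI)
  assume M: "M \<ge> 2" and bd: "bounded M s"
  have c: "1 + acost b s \<le> unit_cost M"
    using acost_le_unit[OF bd M assms(1)] by (simp add: unit_cost_def)
  show "\<exists>t k s'. exec (Cond b c1 c2) s t s' \<and> t \<le> k * unit_cost M \<and> bounded M s' \<and> Q k s'"
  proof (cases "aval b s = 0")
    case True
    obtain t k s' where *: "exec c2 s t s'" "t \<le> k * unit_cost M" "bounded M s'" "Q (1 + k) s'"
      using wpE[OF assms(3)[OF True] M bd] by metis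
    from exec.CondFalse[OF True *(1)] * c show ?thesis
      by (intro exI[of _ "1 + acost b s + t"] exI[of _ "1 + k"] exI[of _ s']) auto
  next
    case False
    obtain t k s' where *: "exec c1 s t s'" "t \<le> k * unit_cost M" "bounded M s'" "Q (1 + k) s'"
      using wpE[OF assms(2)[OF False] M bd] by metis
    from exec.CondTrue[OF False *(1)] * c show ?thesis
      by (intro exI[of _ "1 + acost b s + t"] exI[of _ "1 + k"] exI[of _ s']) auto
  qed
qed

text \<open>The measure limits the number of rounds to \<open>K\<close>. A round costs at most
  \<open>T\<close> for the body and one unit for its test; the last unit pays for the failing test.
  Arrays not written by the body keep their values from the start of the loop.\<close>

lemma wp_While:
  fixes \<mu> :: "state \<Rightarrow> nat"
  assumes b: "asize b \<le> 40" and I: "I s0" and K: "\<mu> s0 \<le> K"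
    and body: "\<And>s. I s \<Longrightarrow> bounded M s \<Longrightarrow> (\<And>x. x \<notin> writes c \<Longrightarrow> s x = s0 x) \<Longrightarrow> aval b s \<noteq> 0 \<Longrightarrow>
      wp M c (\<lambda>k s'. k \<le> T \<and> I s' \<and> \<mu> s' < \<mu> s) s"
    and exit: "\<And>k s. I s \<Longrightarrow> bounded M s \<Longrightarrow> (\<And>x. x \<notin> writes c \<Longrightarrow> s x = s0 x) \<Longrightarrow> aval b s = 0 \<Longrightarrow>
      k \<le> K * (T + 1) + 1 \<Longrightarrow> Q k s"
  shows "wp M (While b c) Q s0"
proof (rule wpI)
  assume M: "M \<ge> 2" and bd: "bounded M s0"
  have "I s \<Longrightarrow> bounded M s \<Longrightarrow> (\<And>x. x \<notin> writes c \<Longrightarrow> s x = s0 x) \<Longrightarrow>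
    \<exists>t k s'. exec (While b c) s t s' \<and> t \<le> k * unit_cost M \<and> k \<le> \<mu> s * (T + 1) + 1 \<and> bounded M s' \<and>
      I s' \<and> (\<forall>x. x \<notin> writes c \<longrightarrow> s' x = s0 x) \<and> aval b s' = 0" for s
  proof (induction "\<mu> s" arbitrary: s rule: less_induct)
    case less
    have c: "1 + acost b s \<le> unit_cost M"
      using acost_le_unit[OF less.prems(2) M b] by (simp add: unit_cost_def)
    show ?case
    proof (cases "aval b s = 0")
      case True
      from exec.WhileFalse[OF True, of c] c less.prems True show ?thesis
        by (intro exI[of _ "1 + acost b s"] exI[of _ 1] exI[of _ s]) auto
    next
      case False
      obtain t1 k1 s1 where 1: "exec c s t1 s1" "t1 \<le> k1 * unit_cost M" "bounded M s1"
        "k1 \<le> T" "I s1" "\<mu> s1 < \<mu> s"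
        using wpE[OF body[OF less.prems False] M less.prems(2)] by metis
      have fr: "s1 x = s0 x" if "x \<notin> writes c" for x
        using exec_frame[OF 1(1) that] less.prems(3)[OF that] by simp
      obtain t2 k2 s2 where 2: "exec (While b c) s1 t2 s2" "t2 \<le> k2 * unit_cost M"
        "k2 \<le> \<mu> s1 * (T + 1) + 1"
        "bounded M s2" "I s2" "\<forall>x. x \<notin> writes c \<longrightarrow> s2 x = s0 x" "aval b s2 = 0"
        using less.hyps[OF 1(6,5,3) fr] by blast
      have "(\<mu> s1 + 1) * (T + 1) \<le> \<mu> s * (T + 1)" using 1(6) by (intro mult_right_mono) auto
      then have "1 + k1 + k2 \<le> \<mu> s * (T + 1) + 1" using 1(4) 2(3) by simp
      moreover have "1 + acost b s + t1 + t2 \<le> (1 + k1 + k2) * unit_cost M"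
        using c 1(2) 2(2) by (simp add: distrib_right)
      ultimately show ?thesis using exec.WhileTrue[OF False 1(1) 2(1)] 2(4-7) by blast
    qed
  qed
  from this[OF I bd] obtain t k s' where *: "exec (While b c) s0 t s'"
    "t \<le> k * unit_cost M" "k \<le> \<mu> s0 * (T + 1) + 1" "bounded M s'" "I s'"
    "\<forall>x. x \<notin> writes c \<longrightarrow> s' x = s0 x" "aval b s' = 0" by auto
  have "\<mu> s0 * (T + 1) + 1 \<le> K * (T + 1) + 1"
    using K by (intro mult_right_mono add_right_mono) auto
  then have "Q k s'" using * exit[of s' k] by auto
  then show "\<exists>t k s'. exec (While b c) s0 t s' \<and> t \<le> k * unit_cost M \<and> bounded M s' \<and> Q k s'"
    using * by blast
qed

subsection \<open>The primality test\<close>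

abbreviation V :: "vname \<Rightarrow> aexp" where "V x \<equiv> Cell x (Const 0)"
abbreviation Set_scalar :: "vname \<Rightarrow> aexp \<Rightarrow> com" (infix "::=" 61) where "x ::= e \<equiv> Assign x (Const 0) e"
notation Seq (infixr ";;" 60)

definition Rem :: "aexp \<Rightarrow> aexp \<Rightarrow> aexp" where
  "Rem e1 e2 = Minus e1 (Times (Quot e1 e2) e2)"

lemma aval_Rem [simp]: "aval (Rem e1 e2) s = aval e1 s mod aval e2 s"
  by (simp add: Rem_def minus_div_mult_eq_mod)

lemma asize_Rem [simp]: "asize (Rem e1 e2) = 3 + 2 * asize e1 + 2 * asize e2"
  by (simp add: Rem_def)

definition powmod_prog :: com where
  "powmod_prog =
    ''r'' ::= Const 1;;
    While (V ''x'')
     (Cond (Rem (V ''x'') (Const 2)) (''r'' ::= Rem (Times (V ''r'') (V ''b'')) (V ''N'')) Skip;;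
      ''b'' ::= Rem (Times (V ''b'') (V ''b'')) (V ''N'');;
      ''x'' ::= Quot (V ''x'') (Const 2))"

lemma writes_powmod [simp]: "writes powmod_prog = {''r'', ''b'', ''x''}"
  by (auto simp: powmod_prog_def)

lemma floorlog_half_less: "x > 0 \<Longrightarrow> floorlog 2 (x div 2) < floorlog 2 (x::nat)"
  by (subst (2) compute_floorlog) auto

lemma wp_powmod:
  assumes N: "s ''N'' 0 = N" "N \<ge> 2" and x: "s ''x'' 0 < 2 ^ L"
  shows "wp M powmod_prog (\<lambda>k s'. k \<le> 5 * L + 2 \<and> s' ''r'' 0 = (s ''b'' 0 ^ s ''x'' 0) mod N) s"
proof (rule wp_bounded)
  assume M: "M \<ge> 2" and b: "bounded M s"
  have NM: "N \<le> M" using boundedD[OF b, of "''N''" 0] N by simp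
  define v where "v = s ''b'' 0 ^ s ''x'' 0"
  \<comment> \<open>Binary exponentiation from the lowest bit: \<open>r * b ^ x\<close> keeps its
    residue while \<open>x\<close> loses one bit per round. The clause \<open>r < N\<close>
    identifies \<open>r\<close> with that residue once \<open>x\<close> is zero.\<close>
  define I where "I t \<longleftrightarrow> t ''r'' 0 < N \<and> t ''r'' 0 * t ''b'' 0 ^ t ''x'' 0 mod N = v mod N" for t :: state
  show "wp M powmod_prog (\<lambda>k s'. k \<le> 5 * L + 2 \<and> s' ''r'' 0 = v mod N) s"
    unfolding powmod_prog_def
  proof (intro wp_Seq wp_Assign, goal_cases)
    case 4
    show ?case
    proof (rule wp_While[where I = I and \<mu> = "\<lambda>t. floorlog 2 (t ''x'' 0)" and K = L and T = 4], goal_cases)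
      case (4 t)
      note * = 4(1,2,4) and fr = 4(3)
      have tN: "t ''N'' 0 = N" using fr[of "''N''"] N by simp
      have xM: "t ''x'' 0 div 2 \<le> M" using boundedD[OF *(2), of "''x''" 0] by linarith
      have modM: "y mod N \<le> M" for y using NM N mod_less_divisor[of N y] by linarith
      have fl: "floorlog 2 (t ''x'' 0 div 2) < floorlog 2 (t ''x'' 0)"
        using * by (intro floorlog_half_less) simp
      have sq: "y * (b * b mod N) ^ k mod N = y * b ^ (2 * k) mod N" for y b k
        by (metis mod_mult_right_eq power_mod power_mult power2_eq_square)
      have ev: "t ''r'' 0 * (t ''b'' 0 * t ''b'' 0 mod N) ^ (t ''x'' 0 div 2) mod N = v mod N"
        if "t ''x'' 0 mod 2 = 0"
      proof -
        have "2 * (t ''x'' 0 div 2) = t ''x'' 0" using that by auto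
        then show ?thesis using * by (simp add: sq I_def)
      qed
      have od: "t ''r'' 0 * t ''b'' 0 mod N * (t ''b'' 0 * t ''b'' 0 mod N) ^ (t ''x'' 0 div 2) mod N = v mod N"
        if "t ''x'' 0 mod 2 = Suc 0"
      proof -
        have "Suc (2 * (t ''x'' 0 div 2)) = t ''x'' 0" using that by presburger
        then have "t ''b'' 0 ^ t ''x'' 0 = t ''b'' 0 * t ''b'' 0 ^ (2 * (t ''x'' 0 div 2))"
          by (simp only: flip: power_Suc)
        then show ?thesis using * by (simp only: sq I_def mod_mult_left_eq mult.assoc)
      qed
      show ?case
        using N(2) xM modM fl ev od *(3)
        by (intro wp_Seq wp_Cond wp_Assign wp_Skip)
          (simp_all add: tN I_def I_def[of t, THEN iffD1, OF *(1)])
    qed (use N x in \<open>simp_all add: I_def v_def floorlog_le_of_less, metis mod_less\<close>)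
  qed (use M in \<open>simp_all\<close>)
qed

text \<open>Continuation form: with an arbitrary postcondition the rule can be chained with those
  for assignments inside larger programs.\<close>

lemma wp_powmod_cont:
  assumes "s ''N'' 0 = N" "N \<ge> 2" "s ''x'' 0 < 2 ^ L"
    and "\<And>k s'. k \<le> 5 * L + 2 \<Longrightarrow> s' ''r'' 0 = (s ''b'' 0 ^ s ''x'' 0) mod N \<Longrightarrow>
      (\<And>x. x \<notin> {''r'', ''b'', ''x''} \<Longrightarrow> s' x = s x) \<Longrightarrow> Q k s'"
  shows "wp M powmod_prog Q s"
proof (rule wp_conseq)
  show "wp M powmod_prog (\<lambda>k s'. k \<le> 5 * L + 2 \<and> s' ''r'' 0 = (s ''b'' 0 ^ s ''x'' 0) mod N) s"
    using assms(1-3) by (rule wp_powmod)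
qed (use assms(4) in auto)

section \<open>Searching for a witness\<close>

definition is_witness :: "nat \<Rightarrow> nat \<Rightarrow> nat \<Rightarrow> bool" where
  "is_witness d e a \<longleftrightarrow> [a ^ d = 1] (mod (d + 1)) \<and> [(a ^ e + d) ^ d = 1] (mod (d + 1))"

text \<open>A test only separates zero from nonzero, so equality with 1 is tested through
  \<open>|x - 1|\<close>, the sum of two truncated differences.\<close>

definition dist_one :: "vname \<Rightarrow> aexp" where
  "dist_one x = Plus (Minus (V x) (Const 1)) (Minus (Const 1) (V x))"

lemma dist_one [simp]: "aval (dist_one x) s = 0 \<longleftrightarrow> s x 0 = 1" "asize (dist_one x) = 11"
  by (auto simp: dist_one_def)

definition witness_body :: com where
  "witness_body =
    ''b'' ::= V ''w'';; ''x'' ::= V ''d'';; powmod_prog;; ''v'' ::= V ''r'';;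
    ''b'' ::= V ''w'';; ''x'' ::= V ''e'';; powmod_prog;;
    ''b'' ::= Plus (V ''r'') (V ''d'');; ''x'' ::= V ''d'';; powmod_prog;;
    Cond (Plus (dist_one ''v'') (dist_one ''r'')) Skip (''u'' ::= Const 1);;
    ''w'' ::= Plus (V ''w'') (Const 1)"

lemma writes_witness [simp]: "writes witness_body = {''r'', ''b'', ''x'', ''v'', ''u'', ''w''}"
  by (auto simp: witness_body_def)

lemma wp_witness_body:
  assumes "s ''d'' 0 = d" "s ''e'' 0 = e" "s ''w'' 0 = a" "s ''N'' 0 = d + 1"
    and "d \<ge> 1" "e \<le> d" "d < 2 ^ L" "2 * d + 1 \<le> M" "a + 1 \<le> M"
  shows "wp M witness_body (\<lambda>k s'. k \<le> 15 * L + 18 \<and> s' ''w'' 0 = a + 1 \<and>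
    s' ''u'' 0 = (if is_witness d e a then 1 else s ''u'' 0)) s"
proof -
  \<comment> \<open>The program takes powers of \<open>(a ^ e mod N) + d\<close>, not of
    \<open>a ^ e + d\<close>; the residues agree. Since \<open>d \<ge> 1\<close>, the residue of 1
    is 1 itself.\<close>
  have g: "is_witness d e a \<longleftrightarrow> a ^ d mod Suc d = Suc 0 \<and> (a ^ e mod Suc d + d) ^ d mod Suc d = Suc 0"
  proof -
    have "(a ^ e mod Suc d + d) ^ d mod Suc d = (a ^ e + d) ^ d mod Suc d"
      by (metis mod_add_left_eq power_mod)
    then show ?thesis using assms(5) by (simp add: is_witness_def cong_def)
  qed
  have m: "y mod Suc d \<le> d" for y using mod_less_divisor[of "Suc d" y] by simp
  \<comment> \<open>The second bound is for the base \<open>r + d\<close>, which can reach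
    \<open>2 * d\<close>.\<close>
  have m': "y mod Suc d \<le> M" "y mod Suc d + d \<le> M" for y using m[of y] assms(8) by linarith+
  show ?thesis
    unfolding witness_body_def using assms(5-9)
    by (intro wp_Seq wp_Cond wp_Assign wp_Skip wp_powmod_cont[where N = "d + 1" and L = L])
      (simp_all add: assms(1-4) g m', blast)
qed

definition search_prog :: com where
  "search_prog =
    ''u'' ::= Const 0;; ''w'' ::= Const 2;;
    While (Minus (Plus (V ''B'') (Const 1)) (V ''w'')) witness_body"

lemma writes_search [simp]: "writes search_prog = {''r'', ''b'', ''x'', ''v'', ''u'', ''w''}"
  by (auto simp: search_prog_def)

lemma wp_search:
  assumes s: "s ''d'' 0 = d" "s ''e'' 0 = e" "s ''B'' 0 = B" "s ''N'' 0 = d + 1"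
    and le: "d \<ge> 1" "e \<le> d" "d < 2 ^ L" "2 * d + 1 \<le> M" "B + 1 \<le> M" "B \<ge> 1"
  shows "wp M search_prog (\<lambda>k s'. k \<le> B * (15 * L + 19) + 3 \<and>
    s' ''u'' 0 = (if \<exists>a\<in>{2..B}. is_witness d e a then 1 else 0)) s"
proof -
  define I where "I t \<longleftrightarrow> 2 \<le> t ''w'' 0 \<and> t ''w'' 0 \<le> B + 1 \<and>
    t ''u'' 0 = (if \<exists>a\<in>{2..<t ''w'' 0}. is_witness d e a then 1 else 0)" for t :: state
  show ?thesis
    unfolding search_prog_def
  proof (intro wp_Seq wp_Assign, goal_cases)
    case 7
    show ?case
    proof (rule wp_While[where I = I and \<mu> = "\<lambda>t. B + 1 - t ''w'' 0" and K = B and T = "15 * L + 18"], goal_cases)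
      case (4 t)
      have eq: "t ''d'' 0 = d" "t ''e'' 0 = e" "t ''N'' 0 = d + 1" "t ''B'' 0 = B"
        using 4(3) s by simp_all
      have w: "t ''w'' 0 + 1 \<le> B + 1" using 4(4) eq by simp
      have set: "{2..<t ''w'' 0 + 1} = insert (t ''w'' 0) {2..<t ''w'' 0}"
        using 4(1) by (auto simp: I_def)
      have W: "wp M witness_body (\<lambda>k s'. k \<le> 15 * L + 18 \<and> s' ''w'' 0 = t ''w'' 0 + 1 \<and>
          s' ''u'' 0 = (if is_witness d e (t ''w'' 0) then 1 else t ''u'' 0)) t"
        by (rule wp_witness_body) (use eq le w in simp_all)
      show ?case
      proof (rule wp_conseq[OF W])
        fix k and t' :: state
        assume *: "k \<le> 15 * L + 18 \<and> t' ''w'' 0 = t ''w'' 0 + 1 \<and>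
          t' ''u'' 0 = (if is_witness d e (t ''w'' 0) then 1 else t ''u'' 0)"
        have "I t'" using 4(1) * w unfolding I_def by (simp only: set) auto
        then show "k \<le> 15 * L + 18 \<and> I t' \<and> B + 1 - t' ''w'' 0 < B + 1 - t ''w'' 0"
          using * w by simp
      qed
    next
      case (5 k t)
      then have "t ''B'' 0 = B" using s by simp
      with 5 have "t ''w'' 0 = B + 1" by (simp add: I_def)
      then have "{2..<t ''w'' 0} = {2..B}" by auto
      then show ?case using 5(1,5) by (simp add: I_def algebra_simps)
    qed (use le in \<open>simp_all add: I_def\<close>)
  qed (use le in simp_all)
qed

text \<open>Entries that do not divide \<open>d\<close> pass vacuously, so the test for any
  \<open>d\<close> can run over one array holding all divisors of \<open>n\<close>.\<close>

definition passes :: "nat \<Rightarrow> nat \<Rightarrow> nat \<Rightarrow> bool" where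
  "passes B d e \<longleftrightarrow> (e dvd d \<longrightarrow> (e + 1)\<^sup>2 \<le> d + 1 \<longrightarrow> (\<exists>a\<in>{2..B}. is_witness d e a))"

text \<open>The first test is a disjunction written as a sum: a nonzero remainder means that
  \<open>e\<close> does not divide \<open>d\<close>, a nonzero truncated difference that
  \<open>(e + 1)^2 > N\<close>.\<close>

definition test_body :: com where
  "test_body =
    ''e'' ::= Cell ''D'' (V ''j'');;
    Cond (Plus (Rem (V ''d'') (V ''e''))
        (Minus (Times (Plus (V ''e'') (Const 1)) (Plus (V ''e'') (Const 1))) (V ''N'')))
      Skip
      (search_prog;; Cond (V ''u'') Skip (''ok'' ::= Const 0));;
    ''j'' ::= Plus (V ''j'') (Const 1)"

lemma writes_test_body [simp]:
  "writes test_body = {''r'', ''b'', ''x'', ''v'', ''u'', ''w'', ''e'', ''ok'', ''j''}"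
  by (auto simp: test_body_def)

lemma wp_search_cont:
  assumes "s ''d'' 0 = d" "s ''e'' 0 = e" "s ''B'' 0 = B" "s ''N'' 0 = d + 1"
    and "d \<ge> 1" "e \<le> d" "d < 2 ^ L" "2 * d + 1 \<le> M" "B + 1 \<le> M" "B \<ge> 1"
    and "\<And>k s'. k \<le> B * (15 * L + 19) + 3 \<Longrightarrow> s' ''u'' 0 = (if \<exists>a\<in>{2..B}. is_witness d e a then 1 else 0) \<Longrightarrow>
      (\<And>x. x \<notin> {''r'', ''b'', ''x'', ''v'', ''u'', ''w''} \<Longrightarrow> s' x = s x) \<Longrightarrow> Q k s'"
  shows "wp M search_prog Q s"
proof (rule wp_conseq)
  show "wp M search_prog (\<lambda>k s'. k \<le> B * (15 * L + 19) + 3 \<and>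
    s' ''u'' 0 = (if \<exists>a\<in>{2..B}. is_witness d e a then 1 else 0)) s"
    using assms(1-10) by (rule wp_search)
qed (use assms(11) in auto)

lemma wp_test_body:
  assumes s: "s ''d'' 0 = d" "s ''j'' 0 = j" "s ''D'' j = e" "s ''B'' 0 = B" "s ''N'' 0 = d + 1"
    and le: "d \<ge> 1" "d < 2 ^ L" "2 * d + 1 \<le> M" "B + 1 \<le> M" "B \<ge> 1" "j + 1 \<le> M"
  shows "wp M test_body (\<lambda>k s'. k \<le> B * (15 * L + 19) + 8 \<and> s' ''j'' 0 = j + 1 \<and>
    s' ''ok'' 0 = (if passes B d e then s ''ok'' 0 else 0)) s"
proof (rule wp_bounded)
  assume b: "bounded M s"
  have eM: "e \<le> M" using boundedD[OF b, of "''D''" j] s by simp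
  have ed: "e dvd d \<Longrightarrow> e \<le> d" using le(1) by (intro dvd_imp_le) auto
  show ?thesis
    unfolding test_body_def
    using le
    by (intro wp_Seq wp_Cond wp_Assign wp_Skip wp_search_cont[where d = d and e = e and B = B and L = L])
      (simp_all add: s eM ed dvd_eq_mod_eq_0[symmetric] passes_def power2_eq_square split: if_splits, blast)
qed

definition test_prog :: com where
  "test_prog =
    ''N'' ::= Plus (V ''d'') (Const 1);; ''ok'' ::= Const 1;; ''j'' ::= Const 0;;
    While (Minus (V ''c'') (V ''j'')) test_body"

lemma writes_test [simp]:
  "writes test_prog = {''r'', ''b'', ''x'', ''v'', ''u'', ''w'', ''e'', ''ok'', ''j'', ''N''}"
  by (auto simp: test_prog_def)

lemma wp_test:
  assumes s: "s ''d'' 0 = d" "s ''B'' 0 = B" "s ''c'' 0 = c"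
    and le: "d \<ge> 1" "d + 1 \<le> 2 ^ L" "2 * d + 1 \<le> M" "B + 1 \<le> M" "c + 1 \<le> M"
    and B: "B = (2 * L) ^ 4" and D: "{e. e dvd d} \<subseteq> s ''D'' ` {..<c}"
  shows "wp M test_prog (\<lambda>k s'. k \<le> c * (B * (15 * L + 19) + 9) + 4 \<and>
    s' ''N'' 0 = d + 1 \<and> s' ''ok'' 0 = (if prime (d + 1) then 1 else 0)) s"
proof -
  define I where "I t \<longleftrightarrow> t ''j'' 0 \<le> c \<and>
    t ''ok'' 0 = (if \<forall>i<t ''j'' 0. passes B d (s ''D'' i) then 1 else 0)" for t :: state
  \<comment> \<open>The search keeps \<open>w \<le> B + 1\<close> and starts with
    \<open>w = 2\<close>, which requires \<open>B \<ge> 1\<close>.\<close>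
  have "L \<noteq> 0" using le by (intro notI) simp
  then have B1: "B \<ge> 1" using B by simp
  have prime: "prime (d + 1) \<longleftrightarrow> (\<forall>i<c. passes B d (s ''D'' i))"
  proof -
    have "prime (d + 1) \<longleftrightarrow> (\<forall>e. passes B d e)"
      using prime_criterion[OF le(1,2) B] by (simp add: passes_def is_witness_def)
    also have "\<dots> \<longleftrightarrow> (\<forall>i<c. passes B d (s ''D'' i))"
      using D by (auto simp: passes_def)
    finally show ?thesis .
  qed
  show ?thesis
    unfolding test_prog_def
  proof (intro wp_Seq wp_Assign, goal_cases)
    case 10
    show ?case
    proof (rule wp_While[where I = I and \<mu> = "\<lambda>t. c - t ''j'' 0" and K = c
          and T = "B * (15 * L + 19) + 8"], goal_cases)
      case (4 t)
      have eq: "t ''d'' 0 = d" "t ''D'' = s ''D''" "t ''B'' 0 = B" "t ''N'' 0 = d + 1" "t ''c'' 0 = c"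
        using 4(3) s by simp_all
      have j: "t ''j'' 0 < c" using 4(4) eq by simp
      have W: "wp M test_body (\<lambda>k s'. k \<le> B * (15 * L + 19) + 8 \<and> s' ''j'' 0 = t ''j'' 0 + 1 \<and>
          s' ''ok'' 0 = (if passes B d (s ''D'' (t ''j'' 0)) then t ''ok'' 0 else 0)) t"
        by (rule wp_test_body) (use eq le j B1 in simp_all)
      show ?case
      proof (rule wp_conseq[OF W])
        fix k and t' :: state
        assume *: "k \<le> B * (15 * L + 19) + 8 \<and> t' ''j'' 0 = t ''j'' 0 + 1 \<and>
          t' ''ok'' 0 = (if passes B d (s ''D'' (t ''j'' 0)) then t ''ok'' 0 else 0)"
        have "I t'" using 4(1) * j unfolding I_def by (auto simp: less_Suc_eq)
        then show "k \<le> B * (15 * L + 19) + 8 \<and> I t' \<and> c - t' ''j'' 0 < c - t ''j'' 0"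
          using * j by simp
      qed
    next
      case (5 k t)
      then have c: "t ''c'' 0 = c" and N: "t ''N'' 0 = d + 1" using s by simp_all
      with 5 have "t ''j'' 0 = c" by (simp add: I_def)
      then show ?case using 5(1,5) N by (simp add: I_def prime[simplified] algebra_simps)
    qed (use le in \<open>simp_all add: I_def\<close>)
  qed (use le s in simp_all)
qed

subsection \<open>Divisors and binary length\<close>

lemma power_mult_prime_cancel:
  fixes p x x' :: nat
  assumes p: "prime p" and eq: "x * p ^ j = x' * p ^ j'" and x: "\<not> p dvd x" "\<not> p dvd x'"
  shows "x = x' \<and> j = j'"
proof -
  have "multiplicity p (y * p ^ i) = i" if "\<not> p dvd y" for y i
    using that p prime_gt_0_nat[OF p] by (cases "y = 0")
      (auto simp: prime_elem_multiplicity_mult_distrib multiplicity_same_power not_dvd_imp_multiplicity_0)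
  then have "j = j'" using x eq by metis
  then show ?thesis using eq prime_gt_0_nat[OF p] by simp
qed

text \<open>Layout of the divisor array after adjoining \<open>p\<close>: block
  \<open>k div z\<close> is the first block times \<open>p ^ (k div z)\<close>. As \<open>p\<close>
  divides no entry of the first block, the power of \<open>p\<close> in an entry determines its
  block.\<close>

lemma bij_betw_divisors_mult_prime_power:
  fixes p n z a :: nat
  assumes p: "prime p" "\<not> p dvd n" and n: "n > 0"
    and D: "bij_betw D {..<z} {d. d dvd n}"
    and D': "\<And>k. k < z * (a + 1) \<Longrightarrow> D' k = D (k mod z) * p ^ (k div z)"
  shows "bij_betw D' {..<z * (a + 1)} {d. d dvd n * p ^ a}"
proof -
  have img: "D ` {..<z} = {d. d dvd n}" and inj: "inj_on D {..<z}"
    using D by (auto simp: bij_betw_def)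
  have z: "z > 0"
  proof (rule Nat.gr0I)
    assume "z = 0"
    then have "{d. d dvd n} = {}" using img by simp
    then show False using one_dvd[of n] by blast
  qed
  have Dn: "D i dvd n" if "i < z" for i using img that by blast
  have nd: "\<not> p dvd D i" if "i < z" for i
    using Dn[OF that] p by (auto intro: dvd_trans)
  have "inj_on D' {..<z * (a + 1)}"
  proof (rule inj_onI)
    fix k l assume kl: "k \<in> {..<z * (a + 1)}" "l \<in> {..<z * (a + 1)}" "D' k = D' l"
    have "D (k mod z) * p ^ (k div z) = D (l mod z) * p ^ (l div z)" using kl D' by simp
    then have "D (k mod z) = D (l mod z) \<and> k div z = l div z"
      using nd z by (intro power_mult_prime_cancel[OF p(1)]) auto
    then have "k mod z = l mod z" "k div z = l div z" using inj z by (auto simp: inj_on_def)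
    then show "k = l" by (metis div_mult_mod_eq)
  qed
  moreover have "D' ` {..<z * (a + 1)} = {d. d dvd n * p ^ a}"
  proof (intro equalityI subsetI)
    fix d assume "d \<in> D' ` {..<z * (a + 1)}"
    then obtain k where k: "k < z * (a + 1)" "d = D' k" by auto
    have "k div z < a + 1" using k z by (simp add: less_mult_imp_div_less mult.commute)
    then have "p ^ (k div z) dvd p ^ a" by (intro le_imp_power_dvd) simp
    then show "d \<in> {d. d dvd n * p ^ a}" using k D' Dn[of "k mod z"] z by (auto intro: mult_dvd_mono)
  next
    fix d assume "d \<in> {d. d dvd n * p ^ a}"
    then obtain b c where bc: "d = b * c" "b dvd n" "c dvd p ^ a"
      using division_decomp[of d n "p ^ a"] by blast
    obtain j where j: "j \<le> a" "c = p ^ j" using bc(3) p divides_primepow_nat by blast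
    obtain i where i: "i < z" "b = D i" using bc(2) img by auto
    have lt: "j * z + i < z * (a + 1)"
    proof -
      have "j * z + i < j * z + z" using i by simp
      also have "\<dots> = (j + 1) * z" by simp
      also have "\<dots> \<le> (a + 1) * z" using j by (intro mult_right_mono) auto
      finally show ?thesis by (simp add: mult.commute)
    qed
    have "D' (j * z + i) = d" using D'[OF lt] i j bc by simp
    then show "d \<in> D' ` {..<z * (a + 1)}" using lt by blast
  qed
  ultimately show ?thesis by (simp add: bij_betw_def)
qed

section \<open>Listing the divisors block by block\<close>

definition copy_body :: com where
  "copy_body =
    Assign ''D'' (V ''c'') (Times (Cell ''D'' (Minus (V ''c'') (V ''z''))) (Cell ''p'' (V ''i'')));;
    ''c'' ::= Plus (V ''c'') (Const 1)"

definition divisors_body :: com where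
  "divisors_body =
    ''z'' ::= V ''c'';; ''y'' ::= Times (V ''c'') (Plus (Cell ''a'' (V ''i'')) (Const 1));;
    While (Minus (V ''y'') (V ''c'')) copy_body;;
    ''i'' ::= Plus (V ''i'') (Const 1)"

lemma writes_copy [simp]: "writes copy_body = {''D'', ''c''}"
  by (auto simp: copy_body_def)

lemma writes_divisors_body [simp]: "writes divisors_body = {''D'', ''c'', ''z'', ''y'', ''i''}"
  by (auto simp: divisors_body_def)

text \<open>The cell \<open>z\<close> places earlier has the same remainder modulo \<open>z\<close>
  and a quotient smaller by one, so multiplying it by \<open>p\<close> once gives the new entry. The
  loop starts at index \<open>z\<close>, the block with quotient 0 being in place.\<close>

lemma wp_copy:
  assumes s: "s ''z'' 0 = z" "s ''y'' 0 = z * m" "s ''c'' 0 = z" "s ''p'' (s ''i'' 0) = p"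
    and z: "z > 0" "m > 0" and le: "z * m \<le> C" "C + 1 \<le> M"
    and bd: "\<And>k. k < z * m \<Longrightarrow> s ''D'' (k mod z) * p ^ (k div z) \<le> M"
  shows "wp M (While (Minus (V ''y'') (V ''c'')) copy_body)
    (\<lambda>k s'. k \<le> 3 * C + 1 \<and> s' ''c'' 0 = z * m \<and>
      (\<forall>k<z * m. s' ''D'' k = s ''D'' (k mod z) * p ^ (k div z))) s"
proof -
  define D where "D = s ''D''"
  define I where "I t \<longleftrightarrow> z \<le> t ''c'' 0 \<and> t ''c'' 0 \<le> z * m \<and>
    (\<forall>k<t ''c'' 0. t ''D'' k = D (k mod z) * p ^ (k div z))" for t :: state
  show ?thesis
  proof (rule wp_While[where I = I and \<mu> = "\<lambda>t. z * m - t ''c'' 0" and K = C and T = 2], goal_cases)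
    case (4 t)
    have eq: "t ''z'' 0 = z" "t ''y'' 0 = z * m" "t ''p'' (t ''i'' 0) = p"
      using 4(3) s by simp_all
    have I: "z \<le> t ''c'' 0" "t ''c'' 0 < z * m"
      "\<And>k. k < t ''c'' 0 \<Longrightarrow> t ''D'' k = D (k mod z) * p ^ (k div z)"
      using 4(1,4) eq by (auto simp: I_def)
    have "t ''D'' (t ''c'' 0 - z) * p = D ((t ''c'' 0 - z) mod z) * p ^ Suc ((t ''c'' 0 - z) div z)"
      using I(3)[of "t ''c'' 0 - z"] I(1) z by (simp only: power_Suc mult_ac)
    also have "\<dots> = D (t ''c'' 0 mod z) * p ^ (t ''c'' 0 div z)"
      using I(1) z by (simp only: le_mod_geq le_div_geq)
    finally have val: "t ''D'' (t ''c'' 0 - z) * p = D (t ''c'' 0 mod z) * p ^ (t ''c'' 0 div z)" .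
    have val_le: "D (t ''c'' 0 mod z) * p ^ (t ''c'' 0 div z) \<le> M" using bd[OF I(2)] by (simp add: D_def)
    have new: "(if k = t ''c'' 0 then D (t ''c'' 0 mod z) * p ^ (t ''c'' 0 div z) else t ''D'' k) =
        D (k mod z) * p ^ (k div z)" if "k < Suc (t ''c'' 0)" for k
      using I(3)[of k] that by (cases "k = t ''c'' 0") simp_all
    have c: "Suc (t ''c'' 0) \<le> M" "Suc (t ''c'' 0) \<le> z * m" using I(2) le by linarith+
    show ?case
      unfolding copy_body_def using I(1) c val_le
      by (intro wp_Seq wp_Assign) (simp_all add: I_def val eq new diff_less_mono2 del: le_mod_geq)
  next
    case 2
    show ?case using s z by (simp add: I_def D_def)
  next
    case (5 k t)
    have "t ''y'' 0 = z * m" using 5(3) s by simp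
    then show ?case using 5(1,4,5) by (simp add: I_def D_def mult.commute)
  qed (use s le in simp_all)
qed

text \<open>The claim about the last entry is carried along because the input does not contain
  \<open>n\<close>: at the end \<open>n\<close> is read off from the last cell of the array.\<close>

lemma wp_divisors_body:
  assumes s: "s ''i'' 0 = i" "s ''p'' i = p" "s ''a'' i = \<alpha>" "s ''c'' 0 = z"
    and D: "bij_betw (s ''D'') {..<z} {d. d dvd n}" "s ''D'' (z - 1) = n"
    and p: "prime p" "\<not> p dvd n" "n > 0"
    and le: "n * p ^ \<alpha> \<le> M" "z * (\<alpha> + 1) \<le> C" "C + 1 \<le> M" "i + 1 \<le> M"
  shows "wp M divisors_body (\<lambda>k s'. k \<le> 3 * C + 4 \<and> s' ''i'' 0 = i + 1 \<and> s' ''c'' 0 = z * (\<alpha> + 1) \<and>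
    bij_betw (s' ''D'') {..<z * (\<alpha> + 1)} {d. d dvd n * p ^ \<alpha>} \<and>
    s' ''D'' (z * (\<alpha> + 1) - 1) = n * p ^ \<alpha>) s"
proof -
  have z: "z > 0"
  proof (rule Nat.gr0I)
    assume "z = 0"
    then have "{d. d dvd n} = {}" using D(1) by (simp add: bij_betw_def)
    then show False using one_dvd[of n] by blast
  qed
  \<comment> \<open>Every value to be written divides \<open>n * p ^ \<alpha>\<close>, by the layout
    of the array, and so respects the memory bound.\<close>
  have bd: "s ''D'' (k mod z) * p ^ (k div z) \<le> M" if k: "k < z * (\<alpha> + 1)" for k
  proof -
    have "bij_betw (\<lambda>k. s ''D'' (k mod z) * p ^ (k div z)) {..<z * (\<alpha> + 1)} {d. d dvd n * p ^ \<alpha>}"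
      by (rule bij_betw_divisors_mult_prime_power[OF p D(1)]) simp
    then have "s ''D'' (k mod z) * p ^ (k div z) dvd n * p ^ \<alpha>"
      using k unfolding bij_betw_def by blast
    then have "s ''D'' (k mod z) * p ^ (k div z) \<le> n * p ^ \<alpha>"
      using p prime_gt_0_nat by (intro dvd_imp_le) auto
    then show ?thesis using le by linarith
  qed
  have "z * 1 \<le> z * (\<alpha> + 1)" by (intro mult_le_mono2) simp
  then have zC: "z \<le> C" using le(2) by linarith
  \<comment> \<open>The last cell is the last one of block \<open>\<alpha>\<close>, hence
    \<open>p ^ \<alpha>\<close> times the old last entry.\<close>
  have last: "(z * (\<alpha> + 1) - 1) mod z = z - 1" "(z * (\<alpha> + 1) - 1) div z = \<alpha>"
  proof -
    obtain w where w: "z = Suc w" using z by (cases z) auto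
    have e: "z * (\<alpha> + 1) - 1 = w + \<alpha> * z" using w by simp
    show "(z * (\<alpha> + 1) - 1) mod z = z - 1" "(z * (\<alpha> + 1) - 1) div z = \<alpha>"
      unfolding e using w by (simp_all only: mod_mult_self1 div_mult_self1) simp_all
  qed
  have L: "wp M (While (Minus (V ''y'') (V ''c'')) copy_body)
    (\<lambda>k s'. k \<le> 3 * C + 1 \<and> s' ''c'' 0 = z * (\<alpha> + 1) \<and>
      (\<forall>k<z * (\<alpha> + 1). s' ''D'' k = t ''D'' (k mod z) * p ^ (k div z))) t"
    if "t ''z'' 0 = z" "t ''y'' 0 = z * (\<alpha> + 1)" "t ''c'' 0 = z" "t ''p'' = s ''p''"
      "t ''i'' = s ''i''" "t ''D'' = s ''D''" for t
    by (rule wp_copy) (use that s z le bd in simp_all)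
  show ?thesis
    unfolding divisors_body_def
  proof (intro wp_Seq wp_Assign, goal_cases)
    case 7
    show ?case
    proof (rule wp_conseq, rule L, goal_cases)
      case (7 k t)
      then have t: "t ''c'' 0 = z * (\<alpha> + 1)" "t ''i'' 0 = i"
        "\<And>k. k < z * (\<alpha> + 1) \<Longrightarrow> t ''D'' k = s ''D'' (k mod z) * p ^ (k div z)"
        using s by simp_all
      have b: "bij_betw (t ''D'') {..<z * (\<alpha> + 1)} {d. d dvd n * p ^ \<alpha>}"
        by (rule bij_betw_divisors_mult_prime_power[OF p D(1) t(3)])
      have "t ''D'' (z * (\<alpha> + 1) - 1) = n * p ^ \<alpha>"
        using t(3)[of "z * (\<alpha> + 1) - 1"] z D(2) unfolding last by simp
      then show ?case using 7(1) b t(1,2) le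
        by (intro wp_Assign) (simp_all)
    qed (use s in simp_all)
  qed (use s le zC in simp_all)
qed

section \<open>Binary length and the search bound\<close>

definition log_prog :: com where
  "log_prog =
    ''x'' ::= V ''n'';; ''L'' ::= Const 0;;
    While (V ''x'') (''x'' ::= Quot (V ''x'') (Const 2);; ''L'' ::= Plus (V ''L'') (Const 1));;
    ''y'' ::= Plus (V ''L'') (V ''L'');; ''y'' ::= Times (V ''y'') (V ''y'');;
    ''B'' ::= Times (V ''y'') (V ''y'')"

lemma writes_log [simp]: "writes log_prog = {''x'', ''L'', ''y'', ''B''}"
  by (auto simp: log_prog_def)

lemma wp_log:
  assumes s: "s ''n'' 0 = n" and L: "floorlog 2 n = L" and M: "(2 * L) ^ 4 \<le> M"
  shows "wp M log_prog (\<lambda>k s'. k \<le> 3 * L + 6 \<and> s' ''B'' 0 = (2 * L) ^ 4) s"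
proof (rule wp_bounded)
  assume "2 \<le> M" "bounded M s"
  then have nM: "n \<le> M" using boundedD[of M s "''n''" 0] s by simp
  have sq: "(L + L) * (L + L) * ((L + L) * (L + L)) = (2 * L) ^ 4"
    by (simp only: power4_eq_xxxx mult_2 mult.assoc)
  \<comment> \<open>The bound is reached by squaring \<open>L + L\<close> twice; the intermediate
    results are no larger than the final one and hence fit into memory.\<close>
  have mono: "x \<le> x * x" for x :: nat by (cases x) auto
  have LM: "L + L \<le> M" "(L + L) * (L + L) \<le> M"
    using mono[of "L + L"] mono[of "(L + L) * (L + L)"] M unfolding sq[symmetric] by linarith+
  define I where "I t \<longleftrightarrow> t ''L'' 0 + floorlog 2 (t ''x'' 0) = L \<and> t ''x'' 0 \<le> M" for t :: state
  show ?thesis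
    unfolding log_prog_def
  proof (intro wp_Seq wp_Assign, goal_cases)
    case 7
    show ?case
    proof (rule wp_While[where I = I and \<mu> = "\<lambda>t. floorlog 2 (t ''x'' 0)" and K = L and T = 2], goal_cases)
      case (4 t)
      have x: "t ''x'' 0 > 0" using 4 by simp
      have fl: "floorlog 2 (t ''x'' 0) = floorlog 2 (t ''x'' 0 div 2) + 1"
        using x by (subst compute_floorlog) auto
      have "t ''x'' 0 \<le> M" "t ''L'' 0 + 1 \<le> M" using 4(1) LM(1) fl by (simp_all add: I_def)
      moreover from this(1) have "t ''x'' 0 div 2 \<le> M" by linarith
      ultimately show ?case using 4(1) fl by (intro wp_Seq wp_Assign) (simp_all add: I_def)
    next
      case (5 k t)
      then have "t ''L'' 0 = L" by (simp add: I_def floorlog_def)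
      then show ?case using 5(5) M LM
        by (intro wp_Seq wp_Assign) (simp_all add: sq)
    qed (use s L nM in \<open>simp_all add: I_def\<close>)
  qed (use s nM in simp_all)
qed

lemma finite_dvd_set: "n > 0 \<Longrightarrow> finite {d. d dvd (n::nat)}"
  using finite_divisors_nat[of n] by simp

lemma prime_dvd_prod_list_powers:
  fixes q :: nat
  assumes "prime q" "\<forall>(p, a)\<in>set xs. prime p" "q dvd (\<Prod>(p, a)\<leftarrow>xs. p ^ a)"
  shows "q \<in> fst ` set xs"
  using assms(2,3)
proof (induction xs)
  case Nil
  then show ?case using assms(1) by auto
next
  case (Cons x xs)
  obtain p a where x: "x = (p, a)" by (cases x)
  show ?case
  proof (cases "q dvd p ^ a")
    case True
    then have "q dvd p" using assms(1) prime_dvd_power by blast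
    then have "q = p" using assms(1) Cons.prems x primes_dvd_imp_eq by auto
    then show ?thesis using x by simp
  next
    case False
    then have "q dvd (\<Prod>(p, a)\<leftarrow>xs. p ^ a)"
      using Cons.prems(2) x assms(1) prime_dvd_mult_iff by auto
    then show ?thesis using Cons by auto
  qed
qed

text \<open>The listed primes are distinct divisors of \<open>n\<close>. This bounds the rounds of
  the outer loop and the cell holding the number of pairs.\<close>

lemma length_le_tau:
  assumes fs: "is_prime_factorisation n fs" and n: "n > 0"
  shows "length fs \<le> tau n"
proof -
  have "fst ` set fs \<subseteq> {d. d dvd n}"
  proof
    fix p assume "p \<in> fst ` set fs"
    then obtain a where pa: "(p, a) \<in> set fs" by auto
    then have "a \<ge> 1" using fs by (auto simp: is_prime_factorisation_def)
    then have "p dvd p ^ a" by (simp add: dvd_power)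
    also have "p ^ a dvd (\<Prod>(p, a)\<leftarrow>fs. p ^ a)"
      using pa by (intro prod_list_dvd) (auto intro: rev_image_eqI)
    finally show "p \<in> {d. d dvd n}" using fs by (simp add: is_prime_factorisation_def)
  qed
  then have "card (fst ` set fs) \<le> tau n"
    unfolding tau_def by (intro card_mono finite_dvd_set n)
  moreover have "card (fst ` set fs) = length fs"
    using fs distinct_card[of "map fst fs"] by (simp add: is_prime_factorisation_def)
  ultimately show ?thesis by simp
qed

definition divisors_prog :: com where
  "divisors_prog =
    Assign ''D'' (Const 0) (Const 1);; ''c'' ::= Const 1;; ''i'' ::= Const 0;;
    While (Minus (V ''s'') (V ''i'')) divisors_body;;
    ''n'' ::= Cell ''D'' (Minus (V ''c'') (Const 1))"

lemma writes_divisors [simp]: "writes divisors_prog = {''D'', ''c'', ''z'', ''y'', ''i'', ''n''}"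
  by (auto simp: divisors_prog_def)

lemma wp_divisors:
  assumes fs: "is_prime_factorisation n fs" and n: "n > 0"
    and s: "s ''s'' 0 = length fs"
      "\<And>i. i < length fs \<Longrightarrow> s ''p'' i = fst (fs ! i)" "\<And>i. i < length fs \<Longrightarrow> s ''a'' i = snd (fs ! i)"
    and C: "C = tau n" and le: "n \<le> M" "C + 1 \<le> M"
  shows "wp M divisors_prog (\<lambda>k s'. k \<le> C * (3 * C + 5) + 5 \<and> s' ''n'' 0 = n \<and> s' ''c'' 0 = C \<and>
    bij_betw (s' ''D'') {..<C} {d. d dvd n}) s"
proof -
  define pre where "pre i = (\<Prod>(p, a)\<leftarrow>take i fs. p ^ a)" for i
  define len where "len = length fs"
  have pre_len: "pre len = n" using fs by (simp add: pre_def len_def is_prime_factorisation_def)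
  have pre_dvd: "pre i dvd n" for i
  proof -
    have "n = (\<Prod>(p, a)\<leftarrow>take i fs @ drop i fs. p ^ a)"
      using fs by (simp add: is_prime_factorisation_def)
    also have "\<dots> = pre i * (\<Prod>(p, a)\<leftarrow>drop i fs. p ^ a)"
      unfolding pre_def map_append prod_list.append ..
    finally show ?thesis by simp
  qed
  have pre_pos: "pre i > 0" for i using pre_dvd[of i] n by (auto intro: Nat.gr0I)
  have pre_Suc: "pre (Suc i) = pre i * fst (fs ! i) ^ snd (fs ! i)" if "i < len" for i
    using that by (simp add: pre_def len_def take_Suc_conv_app_nth case_prod_unfold)
  have prime: "prime (fst (fs ! i))" if "i < len" for i
    using that fs nth_mem[of i fs] by (fastforce simp: len_def is_prime_factorisation_def case_prod_beta)
  \<comment> \<open>Distinctness of the listed primes enters here: the next prime does not divide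
    the product of the powers before it.\<close>
  have ndvd: "\<not> fst (fs ! i) dvd pre i" if i: "i < len" for i
  proof
    assume "fst (fs ! i) dvd pre i"
    moreover have "\<forall>(p, a)\<in>set (take i fs). prime p"
      using fs by (auto simp: is_prime_factorisation_def dest!: in_set_takeD)
    ultimately have "fst (fs ! i) \<in> fst ` set (take i fs)"
      using prime[OF i] prime_dvd_prod_list_powers by (simp add: pre_def)
    then obtain j where j: "j < i" "fst (fs ! j) = fst (fs ! i)"
      using i by (auto simp: len_def in_set_conv_nth)
    then have "map fst fs ! j = map fst fs ! i" using i by (simp add: len_def)
    moreover have "distinct (map fst fs)" using fs by (simp add: is_prime_factorisation_def)
    ultimately have "j = i" using nth_eq_iff_index_eq[of "map fst fs" j i] i j by (simp add: len_def)
    then show False using j by simp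
  qed
  have card_le: "card {d. d dvd pre i} \<le> C" for i
    unfolding C tau_def using pre_dvd[of i] by (intro card_mono finite_dvd_set n) (auto intro: dvd_trans)
  have len_le: "len \<le> C" using length_le_tau[OF fs n] by (simp add: len_def C)
  define I where "I t \<longleftrightarrow> t ''i'' 0 \<le> len \<and>
    bij_betw (t ''D'') {..<t ''c'' 0} {d. d dvd pre (t ''i'' 0)} \<and>
    t ''D'' (t ''c'' 0 - 1) = pre (t ''i'' 0)" for t :: state
  show ?thesis
    unfolding divisors_prog_def
  proof (intro wp_Seq wp_Assign, goal_cases)
    case 10
    show ?case
    proof (rule wp_While[where I = I and \<mu> = "\<lambda>t. len - t ''i'' 0" and K = C and T = "3 * C + 4"], goal_cases)
      case 2
      have "bij_betw ((s ''D'')(0 := 1)) {..<1} {d. d dvd pre 0}"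
        by (auto simp: pre_def bij_betw_def inj_on_def lessThan_Suc)
      then show ?case by (simp add: I_def) (simp add: pre_def)
    next
      case (4 t)
      define i where "i = t ''i'' 0"
      define p where "p = fst (fs ! i)"
      define a where "a = snd (fs ! i)"
      define z where "z = t ''c'' 0"
      have ts: "t ''s'' 0 = len" using 4(3) s by (simp add: len_def)
      then have i: "i < len" using 4(4) by (simp add: i_def)
      have tp: "t ''p'' i = p" "t ''a'' i = a" using 4(3) s i by (simp_all add: len_def p_def a_def)
      have D: "bij_betw (t ''D'') {..<z} {d. d dvd pre i}" "t ''D'' (z - 1) = pre i"
        using 4(1) by (simp_all add: I_def i_def z_def)
      have Suc: "pre (i + 1) = pre i * p ^ a" using pre_Suc[OF i] by (simp add: p_def a_def)
      \<comment> \<open>The length of the next array is known before it is built: it counts the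
        divisors of \<open>pre (i + 1)\<close>, which are divisors of \<open>n\<close>, so it is at
        most \<open>tau n\<close>.\<close>
      have "bij_betw (\<lambda>k. t ''D'' (k mod z) * p ^ (k div z)) {..<z * (a + 1)} {d. d dvd pre i * p ^ a}"
        using prime[OF i] ndvd[OF i]
        by (intro bij_betw_divisors_mult_prime_power[OF _ _ pre_pos[of i] D(1)]) (simp_all add: p_def)
      then have "z * (a + 1) = card {d. d dvd pre (i + 1)}"
        unfolding Suc using bij_betw_same_card by fastforce
      then have zC: "z * (a + 1) \<le> C" using card_le[of "i + 1"] by simp
      have "pre i * p ^ a \<le> n" using pre_dvd[of "i + 1"] n unfolding Suc by (intro dvd_imp_le)
      then have nM: "pre i * p ^ a \<le> M" using le by linarith
      have W: "wp M divisors_body (\<lambda>k s'. k \<le> 3 * C + 4 \<and> s' ''i'' 0 = i + 1 \<and> s' ''c'' 0 = z * (a + 1) \<and>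
        bij_betw (s' ''D'') {..<z * (a + 1)} {d. d dvd pre i * p ^ a} \<and>
        s' ''D'' (z * (a + 1) - 1) = pre i * p ^ a) t"
        by (rule wp_divisors_body)
          (use tp D prime[OF i] ndvd[OF i] pre_pos nM zC le i len_le in \<open>simp_all add: p_def i_def z_def\<close>)
      show ?case
      proof (rule wp_conseq[OF W])
        fix k and t' :: state
        assume *: "k \<le> 3 * C + 4 \<and> t' ''i'' 0 = i + 1 \<and> t' ''c'' 0 = z * (a + 1) \<and>
          bij_betw (t' ''D'') {..<z * (a + 1)} {d. d dvd pre i * p ^ a} \<and>
          t' ''D'' (z * (a + 1) - 1) = pre i * p ^ a"
        then have "t' ''i'' 0 \<le> len" "t' ''i'' 0 = i + 1" using i by linarith+
        then have "I t'" using * unfolding I_def by (simp only: Suc)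
        then show "k \<le> 3 * C + 4 \<and> I t' \<and> len - t' ''i'' 0 < len - t ''i'' 0"
          using * i unfolding i_def by linarith
      qed
    next
      case (5 k t)
      have ts: "t ''s'' 0 = len" using 5(3) s by (simp add: len_def)
      then have i: "t ''i'' 0 = len" using 5(1,4) by (simp add: I_def)
      have D: "bij_betw (t ''D'') {..<t ''c'' 0} {d. d dvd n}" "t ''D'' (t ''c'' 0 - 1) = n"
        using 5(1) i pre_len by (simp_all add: I_def)
      have c: "t ''c'' 0 = C" using bij_betw_same_card[OF D(1)] by (simp add: C tau_def)
      show ?case using D c 5(5) le
        by (intro wp_Assign) (simp_all add: algebra_simps)
    qed (use s len_le in \<open>simp_all add: I_def\<close>)
  qed (use le in simp_all)
qed

text \<open>Induction by splitting off a prime power. For odd \<open>p\<close> one has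
  \<open>p \<le> (p - 1)^2\<close>, so \<open>p ^ k\<close> is at most the square of its totient;
  for \<open>p = 2\<close> a factor 2 is lost, and this happens only once. The result keeps all
  elements of \<open>Psi_star n\<close> of length linear in that of \<open>n\<close>.\<close>

lemma le_twice_totient_power2:
  fixes m :: nat
  shows "m \<le> (if even m then 2 else 1) * (totient m)\<^sup>2"
proof (induction m rule: less_induct)
  case (less m)
  show ?case
  proof (cases "m \<le> 1")
    case True
    then have "m = 0 \<or> m = 1" by auto
    then show ?thesis by auto
  next
    case False
    then obtain p where p: "prime p" "p dvd m" using prime_factor_nat[of m] by auto
    obtain w where w: "m = p ^ multiplicity p m * w" "\<not> p dvd w"
      using multiplicity_decompose'[of m p] p False by (metis not_le not_prime_unit zero_le_one not_less_zero le0)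
    define k where "k = multiplicity p m"
    have k: "k > 0" unfolding k_def using p False by (simp add: prime_multiplicity_gt_zero_iff)
    then obtain j where j: "k = Suc j" by (cases k) auto
    have m: "m = p ^ k * w" using w by (simp add: k_def)
    have w0: "w > 0" using False m by (auto intro: Nat.gr0I)
    have p2: "p \<ge> 2" using p prime_ge_2_nat by blast
    have "w * 1 < w * p ^ k" using w0 p2 k by (intro mult_strict_left_mono one_less_power) auto
    then have "w < m" by (simp add: m mult.commute)
    then have IH: "w \<le> (if even w then 2 else 1) * (totient w)\<^sup>2" by (rule less.IH)
    have cop: "coprime (p ^ k) w" using p w(2) by (simp add: prime_imp_coprime)
    have tp: "totient (p ^ k) = p ^ j * (p - 1)" unfolding j using p by (simp add: totient_prime_power_Suc del: power_Suc)
    have tm: "totient m = totient (p ^ k) * totient w" unfolding m using cop by (rule totient_mult_coprime)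
    have pj: "p ^ j \<le> (p ^ j)\<^sup>2" using p2 by (simp add: power2_eq_square)
    show ?thesis
    proof (cases "p = 2")
      case True
      have ew: "odd w" using w(2) True by simp
      have em: "even m" using p True by simp
      have "totient (p ^ k) = p ^ j" using tp True by simp
      then have "p ^ k \<le> 2 * (totient (p ^ k))\<^sup>2" using pj True by (simp only: j power_Suc)
      then have "p ^ k * w \<le> 2 * (totient (p ^ k))\<^sup>2 * (totient w)\<^sup>2" using IH ew by (intro mult_mono) auto
      then show ?thesis using em by (simp add: tm power_mult_distrib) (simp add: m)
    next
      case False
      have op: "odd p" using p False by (metis primes_dvd_imp_eq two_is_prime_nat)
      have ew: "even w = even m" using op by (simp add: m)
      obtain r where r: "p = r + 3" using False p2 by (metis le_Suc_ex add.commute le_neq_implies_less Suc_leI eval_nat_numeral(3))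
      have "p \<le> (p - 1)\<^sup>2" by (simp add: r power2_eq_square)
      then have "p ^ j * p \<le> (p ^ j)\<^sup>2 * (p - 1)\<^sup>2" using pj by (intro mult_mono) auto
      then have "p ^ k \<le> (totient (p ^ k))\<^sup>2" by (simp only: tp power_mult_distrib) (simp only: j power_Suc2)
      then have "p ^ k * w \<le> (totient (p ^ k))\<^sup>2 * ((if even w then 2 else 1) * (totient w)\<^sup>2)"
        using IH by (intro mult_mono) auto
      then show ?thesis unfolding tm power_mult_distrib m[symmetric] ew by (simp add: mult_ac)
    qed
  qed
qed

subsection \<open>Preimages of divisors under the totient function\<close>

text \<open>The array \<open>f\<close> stores the totients of the entries of \<open>q\<close>, so no
  entry ever has to be factored.\<close>

definition table :: "nat \<Rightarrow> (nat \<Rightarrow> nat) \<Rightarrow> (nat \<Rightarrow> nat) \<Rightarrow> nat set \<Rightarrow> bool" where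
  "table h q f X \<longleftrightarrow> inj_on q {..<h} \<and> q ` {..<h} = X \<and> (\<forall>k<h. f k = totient (q k))"

lemma table_card: "table h q f X \<Longrightarrow> card X = h"
  by (auto simp: table_def card_image)

lemma table_insert:
  assumes "table h q f X" "y \<notin> X"
  shows "table (Suc h) (q(h := y)) (f(h := totient y)) (insert y X)"
proof -
  have img: "(q(h := y)) ` {..<h} = X"
    using assms(1) unfolding table_def by (metis (no_types, lifting) fun_upd_apply image_cong lessThan_iff less_irrefl)
  have inj: "inj_on (q(h := y)) {..<h}"
    using assms(1) by (simp add: table_def inj_on_def)
  have "inj_on (q(h := y)) {..<Suc h}"
    unfolding lessThan_Suc using inj img assms(2) by (simp only: inj_on_insert) simp
  moreover have "(q(h := y)) ` {..<Suc h} = insert y X"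
    unfolding lessThan_Suc image_insert img by simp
  moreover have "\<forall>k<Suc h. (f(h := totient y)) k = totient ((q(h := y)) k)"
    using assms(1) by (simp add: table_def less_Suc_eq)
  ultimately show ?thesis by (simp only: table_def)
qed

text \<open>The stages of the construction: as \<open>S\<close> grows by one prime at a time, this
  set grows from \<open>{1}\<close> to \<open>Psi_star n\<close>.\<close>

definition preimages :: "nat \<Rightarrow> nat set \<Rightarrow> nat set" where
  "preimages n S = {m. totient m dvd n \<and> (\<forall>p. prime p \<longrightarrow> p dvd m \<longrightarrow> p \<in> S)}"

lemma Psi_star_eq: "n > 0 \<Longrightarrow> Psi_star n = {m. totient m dvd n}"
proof -
  assume n: "n > 0"
  have "m \<ge> 1" if "totient m dvd n" for m using that n by (cases m) auto
  then show ?thesis by (auto simp: Psi_star_def Psi_def)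
qed

lemma le_of_totient_dvd:
  assumes "totient m dvd n" "n > 0"
  shows "m \<le> 2 * n\<^sup>2"
proof -
  have "totient m \<le> n" using assms by (auto intro: dvd_imp_le)
  then have "(totient m)\<^sup>2 \<le> n\<^sup>2" by (intro power_mono) auto
  moreover have "m \<le> 2 * (totient m)\<^sup>2" using le_twice_totient_power2[of m] by (auto split: if_splits)
  ultimately show ?thesis by linarith
qed

lemma finite_Psi_star: "n > 0 \<Longrightarrow> finite (Psi_star n)"
  by (rule finite_subset[of _ "{..2 * n\<^sup>2}"]) (auto simp: Psi_star_eq intro: le_of_totient_dvd)

lemma preimages_empty: "n > 0 \<Longrightarrow> preimages n {} = {1}"
proof -
  assume n: "n > 0"
  have "m = 1" if "totient m dvd n" "\<forall>p. prime p \<longrightarrow> \<not> p dvd m" for m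
    using that prime_factor_nat by blast
  then show ?thesis by (auto simp: preimages_def dest: prime_nat_iff[THEN iffD1])
qed

text \<open>Removing the \<open>p\<close>-part of \<open>x\<close> leaves a number whose totient
  divides that of \<open>x\<close>, hence \<open>n\<close>. So every new element is a power of
  \<open>p\<close> times an element of the preceding stage.\<close>

lemma preimages_insert:
  assumes p: "prime p" "p \<notin> S" and n: "n > 0"
  shows "preimages n (insert p S) =
    preimages n S \<union> {m * p ^ e |m e. m \<in> preimages n S \<and> e \<ge> 1 \<and> totient (m * p ^ e) dvd n}"
proof (intro equalityI subsetI)
  fix x assume x: "x \<in> preimages n (insert p S)"
  then have x0: "x > 0" using n by (auto simp: preimages_def intro: Nat.gr0I)
  define e where "e = multiplicity p x"
  have "\<not> is_unit p" using p by auto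
  then obtain m where m: "x = p ^ e * m" "\<not> p dvd m"
    using multiplicity_decompose'[of x p] x0 unfolding e_def by blast
  have "totient m dvd totient x" by (rule totient_dvd) (use m in simp)
  then have mn: "m \<in> preimages n S" using x m by (auto simp: preimages_def)
  show "x \<in> preimages n S \<union> {m * p ^ e |m e. m \<in> preimages n S \<and> e \<ge> 1 \<and> totient (m * p ^ e) dvd n}"
  proof (cases "e = 0")
    case True
    then show ?thesis using m mn by simp
  next
    case False
    have "x = m * p ^ e" "totient (m * p ^ e) dvd n"
      using x m by (simp_all add: preimages_def mult.commute)
    then show ?thesis using mn False by (intro UnI2 CollectI exI[of _ m] exI[of _ e]) auto
  qed
next
  fix x assume "x \<in> preimages n S \<union> {m * p ^ e |m e. m \<in> preimages n S \<and> e \<ge> 1 \<and> totient (m * p ^ e) dvd n}"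
  then show "x \<in> preimages n (insert p S)"
  proof
    assume "x \<in> {m * p ^ e |m e. m \<in> preimages n S \<and> e \<ge> 1 \<and> totient (m * p ^ e) dvd n}"
    then obtain m e where m: "x = m * p ^ e" "m \<in> preimages n S" "totient (m * p ^ e) dvd n" by auto
    have "q \<in> insert p S" if "prime q" "q dvd x" for q
    proof -
      have "q dvd m \<or> q dvd p" using that m prime_dvd_mult_iff prime_dvd_power by blast
      then show ?thesis using that m p primes_dvd_imp_eq by (auto simp: preimages_def)
    qed
    then show ?thesis using m by (simp add: preimages_def)
  qed (auto simp: preimages_def)
qed

section \<open>Adjoining the powers of one prime\<close>

definition extend_step :: com where
  "extend_step =
    Assign ''q'' (V ''h'') (V ''y'');; Assign ''f'' (V ''h'') (V ''g'');;
    ''h'' ::= Plus (V ''h'') (Const 1);;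
    ''g'' ::= Times (V ''g'') (V ''N'');; ''y'' ::= Times (V ''y'') (V ''N'')"

lemma writes_extend_step [simp]: "writes extend_step = {''q'', ''f'', ''h'', ''g'', ''y''}"
  by (auto simp: extend_step_def)

text \<open>Each round appends a new element of \<open>Psi_star n\<close>, so \<open>Z - h\<close>
  is a measure and there are at most \<open>Z\<close> rounds.\<close>

lemma wp_extend_powers:
  assumes s: "s ''n'' 0 = n" "s ''N'' 0 = p" "s ''h'' 0 = h" "s ''y'' 0 = m * p" "s ''g'' 0 = totient (m * p)"
    and tab: "table h (s ''q'') (s ''f'') X" and n: "n > 0" and p: "prime p" "\<not> p dvd m" "p \<le> n + 1"
    and X: "X \<subseteq> Psi_star n" "\<And>e. e \<ge> 1 \<Longrightarrow> m * p ^ e \<notin> X"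
    and le: "card (Psi_star n) + 1 \<le> M" "2 * n\<^sup>2 * (n + 1) \<le> M" and Z: "Z = card (Psi_star n)"
  shows "wp M (While (Minus (Const 1) (Rem (V ''n'') (V ''g''))) extend_step)
    (\<lambda>k s'. k \<le> 6 * Z + 1 \<and> h \<le> s' ''h'' 0 \<and> (\<forall>k<h. s' ''q'' k = s ''q'' k) \<and>
      table (s' ''h'' 0) (s' ''q'') (s' ''f'') (X \<union> {m * p ^ e |e. e \<ge> 1 \<and> totient (m * p ^ e) dvd n})) s"
proof -
  \<comment> \<open>The power held in \<open>y\<close> runs one ahead of the powers that are already
    stored.\<close>
  define Y where "Y e = X \<union> {m * p ^ i |i. 1 \<le> i \<and> i < e}" for e
  define I where "I t \<longleftrightarrow> (\<exists>e\<ge>1. t ''y'' 0 = m * p ^ e \<and> t ''g'' 0 = totient (m * p ^ e) \<and>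
    table (t ''h'' 0) (t ''q'') (t ''f'') (Y e) \<and> (\<forall>i. 1 \<le> i \<longrightarrow> i < e \<longrightarrow> totient (m * p ^ i) dvd n) \<and>
    h \<le> t ''h'' 0 \<and> (\<forall>k<h. t ''q'' k = s ''q'' k))" for t :: state
  have tot_Suc: "totient (m * p ^ Suc e) = totient (m * p ^ e) * p" if e: "e \<ge> 1" for e
  proof -
    obtain j where j: "e = Suc j" using e by (cases e) auto
    have "coprime p m" using p prime_imp_coprime by blast
    then have "coprime m (p ^ i)" for i by (simp add: coprime_commute)
    then have "totient (m * p ^ Suc i) = totient m * (p ^ i * (p - 1))" for i
      using p(1) by (simp only: totient_mult_coprime totient_prime_power_Suc)
    then show ?thesis by (simp only: j) simp
  qed
  show ?thesis
  proof (rule wp_While[where I = I and \<mu> = "\<lambda>t. Z - t ''h'' 0" and K = Z and T = 5], goal_cases)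
    case 2
    have "Y 1 = X" by (auto simp: Y_def)
    then show ?case unfolding I_def using s tab by (intro exI[of _ 1]) simp
  next
    case (4 t)
    obtain e where e: "e \<ge> 1" "t ''y'' 0 = m * p ^ e" "t ''g'' 0 = totient (m * p ^ e)"
      "table (t ''h'' 0) (t ''q'') (t ''f'') (Y e)" "\<forall>i. 1 \<le> i \<longrightarrow> i < e \<longrightarrow> totient (m * p ^ i) dvd n"
      "h \<le> t ''h'' 0" "\<forall>k<h. t ''q'' k = s ''q'' k"
      using 4(1) by (auto simp: I_def)
    have tn: "t ''n'' 0 = n" "t ''N'' 0 = p" using 4(3) s by simp_all
    have dv: "totient (m * p ^ e) dvd n" using 4(4) e tn by (simp add: dvd_eq_mod_eq_0)
    have "m * p ^ e \<noteq> m * p ^ i" if "i < e" for i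
      using power_mult_prime_cancel[OF p(1) _ p(2) p(2), of e i] that by auto
    then have new: "m * p ^ e \<notin> Y e" using X(2)[OF e(1)] by (auto simp: Y_def)
    have Y_Suc: "Y (Suc e) = insert (m * p ^ e) (Y e)" using e(1) by (auto simp: Y_def less_Suc_eq)
    have sub: "Y (Suc e) \<subseteq> Psi_star n"
      using X(1) e(5) dv n by (auto simp: Y_def Psi_star_eq less_Suc_eq)
    have tab': "table (Suc (t ''h'' 0)) ((t ''q'')(t ''h'' 0 := m * p ^ e))
      ((t ''f'')(t ''h'' 0 := totient (m * p ^ e))) (Y (Suc e))"
      unfolding Y_Suc by (rule table_insert[OF e(4) new])
    have hZ: "Suc (t ''h'' 0) \<le> Z"
      using table_card[OF tab'] card_mono[OF finite_Psi_star[OF n] sub] by (simp add: Z)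
    \<comment> \<open>The value that makes the loop stop may lie outside \<open>Psi_star n\<close>,
      but only by one factor \<open>p \<le> n + 1\<close>; this is why the memory bound contains
      \<open>2 * n^2 * (n + 1)\<close>.\<close>
    have yM: "m * p ^ e * p \<le> M"
    proof -
      have "m * p ^ e * p \<le> 2 * n\<^sup>2 * (n + 1)"
        by (rule mult_mono[OF le_of_totient_dvd[OF dv n] p(3)]) simp_all
      then show ?thesis using le by linarith
    qed
    have gM: "totient (m * p ^ e) * p \<le> M"
    proof -
      have "totient (m * p ^ e) * p \<le> m * p ^ e * p" by (intro mult_right_mono totient_le) auto
      then show ?thesis using yM by linarith
    qed
    have bM: "m * p ^ e \<le> M" "totient (m * p ^ e) \<le> M"
      using boundedD[OF 4(2), of "''y''" 0] boundedD[OF 4(2), of "''g''" 0] e by simp_all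
    have I': "I t'" if "t' ''y'' 0 = m * p ^ e * p" "t' ''g'' 0 = totient (m * p ^ e) * p"
      "t' ''h'' 0 = Suc (t ''h'' 0)" "t' ''q'' = (t ''q'')(t ''h'' 0 := m * p ^ e)"
      "t' ''f'' = (t ''f'')(t ''h'' 0 := totient (m * p ^ e))" for t' :: state
      unfolding I_def
    proof (intro exI[of _ "Suc e"] conjI)
      show "\<forall>k<h. t' ''q'' k = s ''q'' k" using that(4) e(6,7) by simp
      show "\<forall>i\<ge>1. i < Suc e \<longrightarrow> totient (m * p ^ i) dvd n" using e(5) dv by (auto simp: less_Suc_eq)
      show "table (t' ''h'' 0) (t' ''q'') (t' ''f'') (Y (Suc e))" using tab' that by simp
    qed (use that e(1,6) tot_Suc in \<open>simp_all add: mult_ac\<close>)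
    show ?case
      unfolding extend_step_def using hZ yM gM bM le(1)
      by (intro wp_Seq wp_Assign)
        (simp_all add: e(2,3) tn I' Z[symmetric] del: power_Suc)
  next
    case (5 k t)
    obtain e where e: "e \<ge> 1" "t ''y'' 0 = m * p ^ e" "t ''g'' 0 = totient (m * p ^ e)"
      "table (t ''h'' 0) (t ''q'') (t ''f'') (Y e)" "\<forall>i. 1 \<le> i \<longrightarrow> i < e \<longrightarrow> totient (m * p ^ i) dvd n"
      "h \<le> t ''h'' 0" "\<forall>k<h. t ''q'' k = s ''q'' k"
      using 5(1) by (auto simp: I_def)
    have tn: "t ''n'' 0 = n" using 5(3) s by simp
    have ndv: "\<not> totient (m * p ^ e) dvd n" using 5(4) e tn by (simp add: dvd_eq_mod_eq_0)
    \<comment> \<open>The totients of \<open>m * p ^ i\<close> form a divisibility chain, so after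
      the first failure no larger exponent can succeed and stopping loses nothing.\<close>
    have "i < e" if "totient (m * p ^ i) dvd n" for i
    proof (rule ccontr)
      assume "\<not> i < e"
      then have "totient (m * p ^ e) dvd totient (m * p ^ i)"
        by (intro totient_dvd mult_dvd_mono le_imp_power_dvd) auto
      then show False using that ndv dvd_trans by blast
    qed
    then have "Y e = X \<union> {m * p ^ e |e. e \<ge> 1 \<and> totient (m * p ^ e) dvd n}"
      using e(5) by (auto simp: Y_def)
    then show ?case using e 5(5) by simp
  qed (simp_all)
qed

text \<open>The first power of \<open>p = d + 1\<close> multiplies the totient by \<open>d\<close>,
  every further power by \<open>p\<close>; hence \<open>g\<close> starts with the factor
  \<open>d\<close> although each step multiplies by \<open>N\<close>.\<close>

definition extend_body :: com where
  "extend_body =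
    ''g'' ::= Times (Cell ''f'' (V ''j'')) (V ''d'');; ''y'' ::= Times (Cell ''q'' (V ''j'')) (V ''N'');;
    While (Minus (Const 1) (Rem (V ''n'') (V ''g''))) extend_step;;
    ''j'' ::= Plus (V ''j'') (Const 1)"

text \<open>The old length is saved in \<open>z\<close>, since the list grows during the loop and
  the appended entries, already divisible by the prime, must not be extended again.\<close>

definition extend_prog :: com where
  "extend_prog =
    ''z'' ::= V ''h'';; ''j'' ::= Const 0;; While (Minus (V ''z'') (V ''j'')) extend_body"

lemma writes_extend_body [simp]: "writes extend_body = {''q'', ''f'', ''h'', ''g'', ''y'', ''j''}"
  by (auto simp: extend_body_def)

lemma writes_extend [simp]: "writes extend_prog = {''q'', ''f'', ''h'', ''g'', ''y'', ''j'', ''z''}"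
  by (auto simp: extend_prog_def)

lemma preimages_subset_Psi_star: "n > 0 \<Longrightarrow> preimages n S \<subseteq> Psi_star n"
  by (auto simp: preimages_def Psi_star_eq)

lemma wp_extend:
  assumes s: "s ''n'' 0 = n" "s ''d'' 0 = d" "s ''N'' 0 = d + 1" "s ''h'' 0 = h"
    and tab: "table h (s ''q'') (s ''f'') (preimages n S)"
    and n: "n > 0" and p: "prime (d + 1)" "d + 1 \<notin> S" "d dvd n"
    and le: "card (Psi_star n) + 1 \<le> M" "2 * n\<^sup>2 * (n + 1) \<le> M" and Z: "Z = card (Psi_star n)"
  shows "wp M extend_prog (\<lambda>k s'. k \<le> Z * (6 * Z + 5) + 3 \<and>
    table (s' ''h'' 0) (s' ''q'') (s' ''f'') (preimages n (insert (d + 1) S))) s"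
proof -
  define p where "p = d + 1"
  define q where "q = s ''q''"
  define P where "P = preimages n S"
  \<comment> \<open>The list after the entries with index below \<open>j\<close> have been
    extended.\<close>
  define W where "W j = P \<union> {q k * p ^ e |k e. k < j \<and> e \<ge> 1 \<and> totient (q k * p ^ e) dvd n}" for j
  have q: "inj_on q {..<h}" "q ` {..<h} = P" using tab by (simp_all add: table_def q_def P_def)
  have qP: "q k \<in> P" if "k < h" for k using q(2) that by blast
  have ndvd: "\<not> p dvd m" if "m \<in> P" for m
    using that p by (auto simp: P_def preimages_def p_def)
  have hZ: "h \<le> Z" unfolding Z using table_card[OF tab]
      card_mono[OF finite_Psi_star[OF n] preimages_subset_Psi_star[OF n]] by metis
  have pr: "prime p" using p by (simp add: p_def)
  have dn: "d \<le> n" using p n by (intro dvd_imp_le)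
  define I where "I t \<longleftrightarrow> t ''j'' 0 \<le> h \<and> h \<le> t ''h'' 0 \<and> (\<forall>k<h. t ''q'' k = q k) \<and>
    table (t ''h'' 0) (t ''q'') (t ''f'') (W (t ''j'' 0))" for t :: state
  have body: "wp M extend_body (\<lambda>k s'. k \<le> 6 * Z + 4 \<and> I s' \<and> h - s' ''j'' 0 < h - t ''j'' 0) t"
    if I: "I t" and bd: "bounded M t" and fr: "t ''n'' = s ''n''" "t ''d'' = s ''d''" "t ''N'' = s ''N''"
      and jh: "t ''j'' 0 < h" for t
  proof -
    define j where "j = t ''j'' 0"
    have j: "j < h" using jh by (simp add: j_def)
    have t: "h \<le> t ''h'' 0" "\<And>k. k < h \<Longrightarrow> t ''q'' k = q k"
      and tt: "table (t ''h'' 0) (t ''q'') (t ''f'') (W j)" using I by (auto simp: I_def j_def)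
    have fj: "t ''f'' j = totient (q j)" using tt j t by (simp add: table_def)
    have qj: "t ''q'' j = q j" using t(2) j by blast
    have tot: "totient (q j) dvd n" using qP[OF j] by (simp add: P_def preimages_def)
    have cop: "coprime (q j) p"
      using ndvd[OF qP[OF j]] pr prime_imp_coprime coprime_commute by blast
    have g: "totient (q j * p) = totient (q j) * d"
      using totient_mult_coprime[OF cop] totient_prime[OF pr] by (simp add: p_def)
    have yM: "q j * p \<le> M"
    proof -
      have "q j * p \<le> 2 * n\<^sup>2 * (n + 1)"
        by (rule mult_mono[OF le_of_totient_dvd[OF tot n]]) (use dn in \<open>simp_all add: p_def\<close>)
      then show ?thesis using le by linarith
    qed
    have gM: "totient (q j) * d \<le> M" using totient_le[of "q j * p"] yM unfolding g by linarith
    have sub: "W j \<subseteq> Psi_star n"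
      using preimages_subset_Psi_star[OF n] n by (auto simp: W_def P_def Psi_star_eq)
    \<comment> \<open>No duplicates arise: old entries are prime to \<open>p\<close>, and an
      extended entry determines its part prime to \<open>p\<close>, hence its index because
      \<open>q\<close> is injective.\<close>
    have new: "q j * p ^ e \<notin> W j" if e: "e \<ge> 1" for e
    proof
      assume "q j * p ^ e \<in> W j"
      then consider "q j * p ^ e \<in> P" | k e' where "k < j" "q j * p ^ e = q k * p ^ e'"
        by (auto simp: W_def)
      then show False
      proof cases
        case 1
        then show ?thesis using ndvd[OF 1] e by (auto simp: dvd_power dvd_mult)
      next
        case 2
        then have "q j = q k"
          using power_mult_prime_cancel[OF pr 2(2) ndvd[OF qP] ndvd[OF qP]] j by simp
        then show ?thesis using q(1) 2(1) j by (auto dest: inj_onD)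
      qed
    qed
    have W_Suc: "W (Suc j) = W j \<union> {q j * p ^ e |e. e \<ge> 1 \<and> totient (q j * p ^ e) dvd n}"
      by (auto simp: W_def less_Suc_eq)
    have L: "wp M (While (Minus (Const 1) (Rem (V ''n'') (V ''g''))) extend_step)
        (\<lambda>k s'. k \<le> 6 * Z + 1 \<and> t ''h'' 0 \<le> s' ''h'' 0 \<and> (\<forall>k<t ''h'' 0. s' ''q'' k = t' ''q'' k) \<and>
          table (s' ''h'' 0) (s' ''q'') (s' ''f'') (W (Suc j))) t'"
      if "t' ''n'' 0 = n" "t' ''N'' 0 = p" "t' ''h'' 0 = t ''h'' 0" "t' ''y'' 0 = q j * p"
        "t' ''g'' 0 = totient (q j * p)" "t' ''q'' = t ''q''" "t' ''f'' = t ''f''" for t'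
      unfolding W_Suc
    proof (rule wp_extend_powers[where s = t', OF that(1-5) _ n pr _ _ sub new le Z])
      show "table (t ''h'' 0) (t' ''q'') (t' ''f'') (W j)" using tt that by simp
      show "\<not> p dvd q j" using ndvd[OF qP[OF j]] .
      show "p \<le> n + 1" using dn by (simp add: p_def)
    qed
    have jM: "j + 1 \<le> M" using j hZ le Z by linarith
    show ?thesis
      unfolding extend_body_def
    proof (intro wp_Seq wp_Assign, goal_cases)
      case 7
      show ?case
      proof (rule wp_conseq, rule L, goal_cases)
        case (8 k t')
        then have t': "t' ''j'' 0 = j" by (simp add: j_def)
        have q': "t' ''q'' k = q k" if "k < h" for k using 8(1) t that by simp
        show ?case
          using 8(1) j t(1) jM q' t'
          by (intro wp_Assign) (simp_all add: I_def j_def[symmetric])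
      qed (use fr s fj qj g in \<open>simp_all add: j_def[symmetric] p_def\<close>)
    qed (use fr s fj qj gM yM in \<open>simp_all add: j_def[symmetric] p_def\<close>)
  qed
  show ?thesis
    unfolding extend_prog_def
  proof (intro wp_Seq wp_Assign, goal_cases)
    case 7
    show ?case
    proof (rule wp_While[where I = I and \<mu> = "\<lambda>t. h - t ''j'' 0" and K = Z and T = "6 * Z + 4"], goal_cases)
      case 2
      have "W 0 = P" by (simp add: W_def)
      then show ?case using s tab by (simp add: I_def q_def P_def)
    next
      case (4 t)
      have "t ''z'' 0 = h" using 4(3) s by simp
      then show ?case using 4 s by (intro body) simp_all
    next
      case (5 k t)
      have "t ''z'' 0 = h" using 5(3) s by simp
      then have j: "t ''j'' 0 = h" using 5(1,4) by (simp add: I_def)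
      have "{q k * p ^ e |k e. k < h \<and> e \<ge> 1 \<and> totient (q k * p ^ e) dvd n} =
          {m * p ^ e |m e. m \<in> q ` {..<h} \<and> e \<ge> 1 \<and> totient (m * p ^ e) dvd n}" by blast
      then have "W h = preimages n (insert p S)"
        unfolding W_def q(2) P_def p_def by (simp only: preimages_insert[OF p(1,2) n])
      then show ?case using 5(1,5) j by (simp add: I_def p_def algebra_simps)
    qed (use hZ in simp_all)
  qed (use s hZ le Z in simp_all)
qed

section \<open>The loop over all divisors\<close>

definition main_body :: com where
  "main_body =
    ''d'' ::= Cell ''D'' (V ''i'');; test_prog;; Cond (V ''ok'') extend_prog Skip;;
    ''i'' ::= Plus (V ''i'') (Const 1)"

definition main_prog :: com where
  "main_prog =
    Assign ''q'' (Const 0) (Const 1);; Assign ''f'' (Const 0) (Const 1);;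
    ''h'' ::= Const 1;; ''i'' ::= Const 0;;
    While (Minus (V ''c'') (V ''i'')) main_body"

lemma writes_main_body [simp]: "writes main_body =
    {''d'', ''r'', ''b'', ''x'', ''v'', ''u'', ''w'', ''e'', ''ok'', ''j'', ''N'',
     ''q'', ''f'', ''h'', ''g'', ''y'', ''z'', ''i''}"
  by (auto simp: main_body_def)

lemma writes_main [simp]: "writes main_prog = writes main_body"
  by (auto simp: main_prog_def)

lemma wp_main:
  assumes s: "s ''n'' 0 = n" "s ''c'' 0 = C" "s ''B'' 0 = B"
    and D: "bij_betw (s ''D'') {..<C} {d. d dvd n}" and n: "n > 0"
    and L: "n < 2 ^ L" and B: "B = (2 * L) ^ 4" and Z: "Z = card (Psi_star n)"
    and le: "Z + 1 \<le> M" "2 * n\<^sup>2 * (n + 1) \<le> M" "2 * n + 1 \<le> M" "B + 1 \<le> M" "C + 1 \<le> M"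
  shows "wp M main_prog (\<lambda>k s'. k \<le> C * (C * (B * (15 * L + 19) + 9) + Z * (6 * Z + 5) + 11) + 5 \<and>
    table (s' ''h'' 0) (s' ''q'') (s' ''f'') (Psi_star n)) s"
proof -
  define D where "D = s ''D''"
  define S where "S i = {D k + 1 |k. k < i \<and> prime (D k + 1)}" for i
  have inj: "inj_on D {..<C}" and img: "D ` {..<C} = {d. d dvd n}"
    using assms(4) by (simp_all add: bij_betw_def D_def)
  \<comment> \<open>A prime \<open>p\<close> dividing \<open>m\<close> satisfies
    \<open>p - 1 dvd totient m\<close>, so \<open>p - 1\<close> is a divisor of \<open>n\<close> and
    occurs in the array; after the loop no relevant prime is missing.\<close>
  have S_C: "preimages n (S C) = Psi_star n"
  proof
    show "Psi_star n \<subseteq> preimages n (S C)"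
    proof
      fix m assume "m \<in> Psi_star n"
      then have m: "totient m dvd n" using n by (simp add: Psi_star_eq)
      have "p \<in> S C" if p: "prime p" "p dvd m" for p
      proof -
        have "p - 1 dvd totient m" using totient_dvd[OF p(2)] p(1) by (simp add: totient_prime)
        then have "p - 1 \<in> D ` {..<C}" using m img by (auto intro: dvd_trans)
        then obtain k where "k < C" "D k = p - 1" by auto
        then show ?thesis using p prime_gt_0_nat[OF p(1)] by (auto simp: S_def intro!: exI[of _ k])
      qed
      then show "m \<in> preimages n (S C)" using m by (simp add: preimages_def)
    qed
  qed (rule preimages_subset_Psi_star[OF n])
  define I where "I t \<longleftrightarrow> t ''i'' 0 \<le> C \<and>
    table (t ''h'' 0) (t ''q'') (t ''f'') (preimages n (S (t ''i'' 0)))" for t :: state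
  define T where "T = C * (B * (15 * L + 19) + 9) + Z * (6 * Z + 5) + 10"
  have body: "wp M main_body (\<lambda>k s'. k \<le> T \<and> I s' \<and> C - s' ''i'' 0 < C - t ''i'' 0) t"
    if I: "I t" and fr: "t ''n'' 0 = n" "t ''c'' 0 = C" "t ''B'' 0 = B" "t ''D'' = D"
      and iC: "t ''i'' 0 < C" for t
  proof -
    define i where "i = t ''i'' 0"
    define d where "d = D i"
    have i: "i < C" using iC by (simp add: i_def)
    have dn: "d dvd n" using img i by (auto simp: d_def)
    then have d0: "d > 0" "d \<le> n" using n by (auto intro: dvd_imp_le Nat.gr0I)
    have tab: "table (t ''h'' 0) (t ''q'') (t ''f'') (preimages n (S i))"
      using I by (simp add: I_def i_def)
    \<comment> \<open>The divisors are listed without repetition, so no prime is adjoined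
      twice.\<close>
    have nS: "d + 1 \<notin> S i" using inj i by (auto simp: S_def d_def dest: inj_onD)
    have S_Suc: "S (Suc i) = (if prime (d + 1) then insert (d + 1) (S i) else S i)"
      by (auto simp: S_def d_def less_Suc_eq)
    have test: "wp M test_prog (\<lambda>k s'. k \<le> C * (B * (15 * L + 19) + 9) + 4 \<and>
        s' ''N'' 0 = d + 1 \<and> s' ''ok'' 0 = (if prime (d + 1) then 1 else 0)) t'"
      if "t' ''d'' 0 = d" "t' ''B'' 0 = B" "t' ''c'' 0 = C" "t' ''D'' = D" for t'
    proof -
      have "{e. e dvd d} \<subseteq> t' ''D'' ` {..<C}" using dn that(4) img by (auto intro: dvd_trans)
      then show ?thesis by (intro wp_test) (use that B d0 L le in simp_all)
    qed
    have ext: "wp M extend_prog (\<lambda>k s'. k \<le> Z * (6 * Z + 5) + 3 \<and>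
        table (s' ''h'' 0) (s' ''q'') (s' ''f'') (preimages n (S (Suc i)))) t'"
      if "t' ''n'' 0 = n" "t' ''d'' 0 = d" "t' ''N'' 0 = d + 1" "t' ''h'' = t ''h''" "t' ''q'' = t ''q''"
        "t' ''f'' = t ''f''" "prime (d + 1)" for t'
      using wp_extend[where s = t', OF that(1-3) refl _ n that(7) nS dn _ le(2) Z] that tab le(1)
      by (simp add: S_Suc Z)
    have iM: "i + 1 \<le> M" using i le by linarith
    have dM: "d \<le> M" using d0 le by linarith
    have step: "wp M (''i'' ::= Plus (V ''i'') (Const 1)) (\<lambda>k s'. F k \<le> T \<and> I s' \<and> C - s' ''i'' 0 < C - t ''i'' 0) t'"
      if "t' ''i'' 0 = i" "F 1 \<le> T" "table (t' ''h'' 0) (t' ''q'') (t' ''f'') (preimages n (S (Suc i)))" for t' and F :: "nat \<Rightarrow> nat"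
      by (rule wp_Assign) (use that iM i in \<open>simp_all add: I_def i_def\<close>)
    show ?thesis
      unfolding main_body_def
    proof (intro wp_Seq wp_Assign, goal_cases)
      case 4
      show ?case
      proof (rule wp_conseq, rule test, goal_cases)
        case (5 k t')
        have t': "t' ''n'' 0 = n" "t' ''d'' 0 = d" "t' ''N'' 0 = d + 1" "t' ''h'' = t ''h''" "t' ''q'' = t ''q''"
          "t' ''f'' = t ''f''" "t' ''i'' 0 = i" using 5(1,3) fr by (simp_all add: i_def d_def)
        show ?case
        proof (intro wp_Seq wp_Cond wp_Skip, goal_cases)
          case 2
          then have pr: "prime (d + 1)" using 5(1) by (simp split: if_splits)
          show ?case
            by (rule wp_conseq, rule ext[OF t'(1-6) pr], rule step)
              (use 5(1) t'(7) in \<open>simp_all add: T_def\<close>)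
        next
          case 3
          then have pr: "\<not> prime (d + 1)" using 5(1) by (simp split: if_splits)
          show ?case
            by (rule step) (use 5(1) t' tab pr in \<open>simp_all add: T_def S_Suc\<close>)
        qed simp
      qed (use fr in \<open>simp_all add: d_def i_def\<close>)
    qed (use dM fr in \<open>simp_all add: d_def i_def\<close>)
  qed
  show ?thesis
    unfolding main_prog_def
  proof (intro wp_Seq wp_Assign, goal_cases)
    case 13
    show ?case
    proof (rule wp_While[where I = I and \<mu> = "\<lambda>t. C - t ''i'' 0" and K = C and T = T], goal_cases)
      case 2
      have "S 0 = {}" by (simp add: S_def)
      then have "table 1 ((s ''q'')(0 := 1)) ((s ''f'')(0 := 1)) (preimages n (S 0))"
        using preimages_empty[OF n] by (simp add: table_def lessThan_Suc)
      then show ?case by (simp add: I_def)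
    next
      case (4 t)
      have fr: "t ''n'' 0 = n" "t ''c'' 0 = C" "t ''B'' 0 = B" "t ''D'' = D"
        using 4(3) s by (simp_all add: D_def)
      show ?case by (rule body[OF 4(1) fr]) (use 4(4) fr in simp)
    next
      case (5 k t)
      have "t ''c'' 0 = C" using 5(3) s by simp
      then have "t ''i'' 0 = C" using 5(1,4) by (simp add: I_def)
      then show ?case using 5(1,5) S_C by (simp add: I_def T_def algebra_simps)
    qed (simp_all)
  qed (use le in simp_all)
qed

section \<open>Selecting the preimages of the given number\<close>

definition filter_body :: com where
  "filter_body =
    Cond (Minus (V ''n'') (Cell ''f'' (V ''i''))) Skip
     (Assign ''m'' (V ''k'') (Cell ''q'' (V ''i''));; ''k'' ::= Plus (V ''k'') (Const 1));;
    ''i'' ::= Plus (V ''i'') (Const 1)"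

definition filter_prog :: com where
  "filter_prog =
    ''k'' ::= Const 0;; ''i'' ::= Const 0;; While (Minus (V ''h'') (V ''i'')) filter_body"

lemma writes_filter_body [simp]: "writes filter_body = {''m'', ''k'', ''i''}"
  by (auto simp: filter_body_def)

lemma output_list_snoc:
  assumes "t' ''k'' 0 = Suc (t ''k'' 0)" "t' ''m'' = (t ''m'')(t ''k'' 0 := v)"
  shows "output_list t' = output_list t @ [v]"
  using assms by (simp add: output_list_def)

lemma wp_filter:
  assumes s: "s ''n'' 0 = n" "s ''h'' 0 = h" and tab: "table h (s ''q'') (s ''f'') (Psi_star n)"
    and n: "n > 0" and le: "h + 1 \<le> M"
  shows "wp M filter_prog (\<lambda>k s'. k \<le> 5 * h + 3 \<and> distinct (output_list s') \<and> set (output_list s') = Psi n) s"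
proof -
  define q where "q = s ''q''"
  define f where "f = s ''f''"
  have q: "inj_on q {..<h}" "q ` {..<h} = Psi_star n" "\<And>k. k < h \<Longrightarrow> f k = totient (q k)"
    using tab by (auto simp: table_def q_def f_def)
  \<comment> \<open>The stored totients divide \<open>n\<close>. Hence the truncated difference
    \<open>n - f k\<close>, which the program tests, vanishes exactly when the totient equals
    \<open>n\<close>.\<close>
  have fn: "f k \<le> n" if "k < h" for k
  proof -
    have "q k \<in> Psi_star n" using q(2) that by blast
    then show ?thesis using n q(3)[OF that] by (auto simp: Psi_star_eq intro: dvd_imp_le)
  qed
  define sel where "sel i = map q (filter (\<lambda>k. f k = n) [0..<i])" for i
  have sel_len: "length (sel i) \<le> i" for i
    using length_filter_le[of "\<lambda>k. f k = n" "[0..<i]"] by (simp add: sel_def)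
  have sel_h: "distinct (sel h)" "set (sel h) = Psi n"
  proof -
    show "distinct (sel h)" using q(1) by (auto simp: sel_def distinct_map intro: inj_on_subset)
    have "set (sel h) = {m \<in> q ` {..<h}. totient m = n}" using q(3) by (auto simp: sel_def)
    also have "\<dots> = Psi n" unfolding q(2) by (auto simp: Psi_star_def Psi_def)
    finally show "set (sel h) = Psi n" .
  qed
  define I where "I t \<longleftrightarrow> t ''i'' 0 \<le> h \<and> output_list t = sel (t ''i'' 0)" for t :: state
  show ?thesis
    unfolding filter_prog_def
  proof (intro wp_Seq wp_Assign, goal_cases)
    case 7
    show ?case
    proof (rule wp_While[where I = I and \<mu> = "\<lambda>t. h - t ''i'' 0" and K = h and T = 4], goal_cases)
      case 2
      show ?case by (simp add: I_def output_list_def sel_def)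
    next
      case (4 t)
      define i where "i = t ''i'' 0"
      have fr: "t ''n'' 0 = n" "t ''h'' 0 = h" "t ''q'' = q" "t ''f'' = f"
        using 4(3) s by (simp_all add: q_def f_def)
      have i: "i < h" using 4(4) fr by (simp add: i_def)
      have out: "output_list t = sel i" using 4(1) by (simp add: I_def i_def)
      then have "t ''k'' 0 = length (sel i)" by (metis diff_zero length_map length_upt output_list_def)
      then have k: "t ''k'' 0 \<le> i" using sel_len[of i] by simp
      have bq: "q i \<le> M" using boundedD[OF 4(2), of "''q''" i] fr by simp
      have eqn: "f i = n \<longleftrightarrow> n - f i = 0" using fn[OF i] by auto
      have I1: "I t'" if "t' ''i'' 0 = i + 1" "f i = n" "t' ''k'' 0 = Suc (t ''k'' 0)"
        "t' ''m'' = (t ''m'')(t ''k'' 0 := q i)" for t' :: state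
        using output_list_snoc[OF that(3,4)] that(1,2) out i by (simp add: I_def sel_def)
      have I2: "I t'" if "t' ''i'' 0 = i + 1" "f i \<noteq> n" "t' ''k'' = t ''k''" "t' ''m'' = t ''m''" for t' :: state
        using that out i by (simp add: I_def sel_def output_list_def)
      show ?case
      proof (cases "f i = n")
        case True
        then show ?thesis
          unfolding filter_body_def using i k le bq
          by (intro wp_Seq wp_Cond wp_Assign wp_Skip) (simp_all add: fr i_def[symmetric] I1)
      next
        case False
        then show ?thesis
          unfolding filter_body_def using i k le bq fn[OF i]
          by (intro wp_Seq wp_Cond wp_Assign wp_Skip) (simp_all add: fr i_def[symmetric] I2)
      qed
    next
      case (5 k t)
      have "t ''h'' 0 = h" using 5(3) s by simp
      then have "t ''i'' 0 = h" using 5(1,4) by (simp add: I_def)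
      then show ?case using 5(1,5) sel_h by (simp add: I_def)
    qed (use s in simp_all)
  qed (simp_all)
qed

subsection \<open>The complete program and its running time\<close>

definition Psi_prog :: com where
  "Psi_prog = divisors_prog;; log_prog;; main_prog;; filter_prog"

lemma divisor_count_ge_2:
  assumes "n \<ge> 2"
  shows "tau n \<ge> 2"
proof -
  have "card {1, n} \<le> tau n"
    unfolding tau_def using assms by (intro card_mono finite_dvd_set) auto
  then show ?thesis using assms by simp
qed

lemma card_Psi_star_ge_2:
  assumes "n \<ge> 2"
  shows "card (Psi_star n) \<ge> 2"
proof -
  have "card {1, 2::nat} \<le> card (Psi_star n)"
    using assms by (intro card_mono finite_Psi_star) (auto simp: Psi_star_eq)
  then show ?thesis by simp
qed

text \<open>A sum of what the phases require: table entries one power too far, bases of the modular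
  powers, the lengths of the two lists, and the search bound. The additive constants leave room for
  counters running one beyond the end.\<close>

definition memory_bound :: "nat \<Rightarrow> nat" where
  "memory_bound n = 2 * n\<^sup>2 * (n + 1) + 2 * n + 1 + card (Psi_star n) + tau n + (2 * floorlog 2 n) ^ 4 + 3"

text \<open>The four summands belong to the divisor list, the binary length, the main loop and the
  final selection.\<close>

definition step_bound :: "nat \<Rightarrow> nat \<Rightarrow> nat \<Rightarrow> nat" where
  "step_bound C L Z = (C * (3 * C + 5) + 5) + (3 * L + 6) +
    (C * (C * ((2 * L) ^ 4 * (15 * L + 19) + 9) + Z * (6 * Z + 5) + 11) + 5) + (5 * Z + 3)"

lemma wp_Psi_prog:
  assumes fs: "is_prime_factorisation n fs" and n: "n \<ge> 2"
  shows "wp (memory_bound n) Psi_prog (\<lambda>k s'. k \<le> step_bound (tau n) (floorlog 2 n) (card (Psi_star n)) \<and>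
    distinct (output_list s') \<and> set (output_list s') = Psi n) (input_state fs)"
proof -
  define M where "M = memory_bound n"
  define C where "C = tau n"
  define L where "L = floorlog 2 n"
  define B where "B = (2 * L) ^ 4"
  define Z where "Z = card (Psi_star n)"
  have M: "M = 2 * n\<^sup>2 * (n + 1) + 2 * n + 1 + Z + C + B + 3"
    by (simp add: M_def memory_bound_def Z_def C_def B_def L_def)
  have nL: "n < 2 ^ L" using floorlog_bounds[of n 2] n by (simp add: L_def)
  have n0: "n > 0" using n by simp
  have le: "Z + 1 \<le> M" "2 * n\<^sup>2 * (n + 1) \<le> M" "2 * n + 1 \<le> M" "B + 1 \<le> M" "C + 1 \<le> M" "n \<le> M"
    by (simp_all add: M)
  have sb: "step_bound C L Z = (C * (3 * C + 5) + 5) + (3 * L + 6) +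
    (C * (C * (B * (15 * L + 19) + 9) + Z * (6 * Z + 5) + 11) + 5) + (5 * Z + 3)"
    by (simp only: step_bound_def B_def)
  have d: "wp M divisors_prog (\<lambda>k s'. k \<le> C * (3 * C + 5) + 5 \<and> s' ''n'' 0 = n \<and> s' ''c'' 0 = C \<and>
    bij_betw (s' ''D'') {..<C} {d. d dvd n}) (input_state fs)"
    by (rule wp_divisors[OF fs n0]) (use le in \<open>simp_all add: input_state_def C_def\<close>)
  show ?thesis
    unfolding Psi_prog_def M_def[symmetric] C_def[symmetric] L_def[symmetric] Z_def[symmetric]
  proof (rule wp_Seq, rule wp_conseq[OF d])
    fix k1 and s1 :: state
    assume 1: "k1 \<le> C * (3 * C + 5) + 5 \<and> s1 ''n'' 0 = n \<and> s1 ''c'' 0 = C \<and>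
      bij_betw (s1 ''D'') {..<C} {d. d dvd n}"
    have l: "wp M log_prog (\<lambda>k s'. k \<le> 3 * L + 6 \<and> s' ''B'' 0 = B) s1"
      unfolding B_def by (rule wp_log) (use 1 le in \<open>simp_all add: L_def B_def\<close>)
    show "wp M (log_prog;; main_prog;; filter_prog) (\<lambda>k s'.
        k1 + k \<le> step_bound C L Z \<and> distinct (output_list s') \<and> set (output_list s') = Psi n) s1"
    proof (rule wp_Seq, rule wp_conseq[OF l])
      fix k2 and s2 :: state
      assume 2: "k2 \<le> 3 * L + 6 \<and> s2 ''B'' 0 = B" and fr2: "\<And>x. x \<notin> writes log_prog \<Longrightarrow> s2 x = s1 x"
      have s2: "s2 ''n'' 0 = n" "s2 ''c'' 0 = C" "s2 ''B'' 0 = B" "s2 ''D'' = s1 ''D''"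
        using 1 2 fr2 by simp_all
      have m: "wp M main_prog (\<lambda>k s'. k \<le> C * (C * (B * (15 * L + 19) + 9) + Z * (6 * Z + 5) + 11) + 5 \<and>
          table (s' ''h'' 0) (s' ''q'') (s' ''f'') (Psi_star n)) s2"
        by (rule wp_main) (use 1 s2 n0 nL le in \<open>simp_all add: B_def Z_def\<close>)
      show "wp M (main_prog;; filter_prog) (\<lambda>k s'.
        k1 + (k2 + k) \<le> step_bound C L Z \<and> distinct (output_list s') \<and> set (output_list s') = Psi n) s2"
      proof (rule wp_Seq, rule wp_conseq[OF m])
        fix k3 and s3 :: state
        assume 3: "k3 \<le> C * (C * (B * (15 * L + 19) + 9) + Z * (6 * Z + 5) + 11) + 5 \<and>
            table (s3 ''h'' 0) (s3 ''q'') (s3 ''f'') (Psi_star n)"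
          and fr3: "\<And>x. x \<notin> writes main_prog \<Longrightarrow> s3 x = s2 x"
        have hZ: "s3 ''h'' 0 = Z" using table_card[OF conjunct2[OF 3]] unfolding Z_def by simp
        have f: "wp M filter_prog (\<lambda>k s'. k \<le> 5 * Z + 3 \<and> distinct (output_list s') \<and>
            set (output_list s') = Psi n) s3"
          by (rule wp_filter) (use 3 fr3 s2 hZ n0 le in simp_all)
        show "wp M filter_prog (\<lambda>k4 s'. k1 + (k2 + (k3 + k4)) \<le> step_bound C L Z \<and>
            distinct (output_list s') \<and> set (output_list s') = Psi n) s3"
          by (rule wp_conseq[OF f]) (use 1 2 3 in \<open>simp add: sb\<close>)
      qed
    qed
  qed
qed

section \<open>Polynomial bounds for memory and time\<close>

lemma bounded_input_state:
  assumes fs: "is_prime_factorisation n fs" and n: "n \<ge> 2"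
  shows "bounded (memory_bound n) (input_state fs)"
proof -
  \<comment> \<open>Exponents are bounded through
    \<open>a < 2 ^ a \<le> p ^ a \<le> n\<close>.\<close>
  have pa: "p \<le> n \<and> a \<le> n" if "(p, a) \<in> set fs" for p a
  proof -
    have p: "prime p" "a \<ge> 1" using that fs by (auto simp: is_prime_factorisation_def)
    have "p ^ a dvd (\<Prod>(p, a)\<leftarrow>fs. p ^ a)"
      using that by (intro prod_list_dvd) (auto intro: rev_image_eqI)
    then have "p ^ a dvd n" using fs by (simp add: is_prime_factorisation_def)
    then have le: "p ^ a \<le> n" using n by (intro dvd_imp_le) auto
    have "p \<le> p ^ a" using p prime_ge_1_nat power_increasing[of 1 a p] by simp
    moreover have "a < 2 ^ a" by (rule less_exp)
    moreover have "2 ^ a \<le> p ^ a" using p prime_ge_2_nat by (intro power_mono) auto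
    ultimately show ?thesis using le by linarith
  qed
  have i: "fst (fs ! i) \<le> n" "snd (fs ! i) \<le> n" if "i < length fs" for i
    using pa[of "fst (fs ! i)" "snd (fs ! i)"] that by simp_all
  have "length fs \<le> tau n" using n by (intro length_le_tau[OF fs]) simp
  then show ?thesis using i unfolding bounded_def memory_bound_def input_state_def
    by (fastforce intro: order_trans)
qed

text \<open>Each of the six summands is at most \<open>2 ^ (8 * W)\<close>, the exponent 8 coming
  from \<open>(2 * L) ^ 4 \<le> 2 ^ (8 * L)\<close>; the sum of six such terms costs three more
  bits.\<close>

lemma memory_bound_bits:
  assumes n: "n \<ge> 2" and W: "W = card (Psi_star n) + tau n + floorlog 2 n"
  shows "floorlog 2 (memory_bound n) \<le> 8 * W + 3"
proof (rule floorlog_le_of_less)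
  define C where "C = tau n"
  define L where "L = floorlog 2 n"
  define Z where "Z = card (Psi_star n)"
  have W: "W = Z + C + L" by (simp add: W C_def L_def Z_def)
  have C2: "C \<ge> 2" and Z2: "Z \<ge> 2"
    using divisor_count_ge_2[OF n] card_Psi_star_ge_2[OF n] by (simp_all add: C_def Z_def)
  have nL: "n + 1 \<le> 2 ^ L" using floorlog_bounds[of n 2] n by (simp add: L_def)
  let ?E = "(2::nat) ^ (8 * W)"
  have up: "x \<le> ?E" if "x \<le> 2 ^ e" "e \<le> 8 * W" for x e
    using that power_increasing[of e "8 * W" "2::nat"] by linarith
  have "n\<^sup>2 * (n + 1) \<le> (2 ^ L)\<^sup>2 * 2 ^ L" using nL by (intro mult_mono power_mono) auto
  also have "\<dots> = 2 ^ (3 * L)" by (simp flip: power_mult power_add)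
  finally have "2 * n\<^sup>2 * (n + 1) \<le> 2 ^ Suc (3 * L)" by simp
  then have 1: "2 * n\<^sup>2 * (n + 1) \<le> ?E" by (rule up) (use W C2 in simp)
  have "2 * n + 1 \<le> 2 ^ Suc L" using nL by simp
  then have 2: "2 * n + 1 \<le> ?E" by (rule up) (use W C2 in simp)
  have 3: "Z \<le> ?E" by (rule up[OF less_imp_le[OF less_exp]]) (use W in simp)
  have 4: "C \<le> ?E" by (rule up[OF less_imp_le[OF less_exp]]) (use W in simp)
  have "(2 * L) ^ 4 \<le> (2 ^ (2 * L)) ^ 4" using less_exp[of "2 * L"] by (intro power_mono) auto
  also have "\<dots> = 2 ^ (8 * L)" by (simp flip: power_mult)
  finally have 5: "(2 * L) ^ 4 \<le> ?E" by (rule up) (use W in simp)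
  have 6: "3 \<le> ?E" by (rule up[of _ 2]) (use W C2 in simp_all)
  have "memory_bound n \<le> 6 * ?E"
    using 1 2 3 4 5 6 unfolding memory_bound_def C_def L_def Z_def by linarith
  also have "\<dots> < 2 ^ (8 * W + 3)" by (simp add: power_add)
  finally show "memory_bound n < 2 ^ (8 * W + 3)" .
qed

lemma unit_cost_le:
  assumes n: "n \<ge> 2" and W: "W = card (Psi_star n) + tau n + floorlog 2 n" "W \<ge> 6"
  shows "unit_cost (memory_bound n) \<le> W ^ 7"
proof -
  \<comment> \<open>The unit cost is at most \<open>25600 * W + 9681\<close>, which is below
    \<open>6 ^ 6 * W\<close>.\<close>
  have "6 ^ 6 \<le> W ^ 6" using W by (intro power_mono) auto
  then have "6 ^ 6 * W \<le> W ^ 6 * W" by (intro mult_right_mono) auto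
  moreover have "W ^ 6 * W = W ^ 7" by (simp add: power_numeral_reduce)
  ultimately show ?thesis using memory_bound_bits[OF n W(1)] W(2) unfolding unit_cost_def by simp
qed

text \<open>Constants are absorbed by \<open>W \<ge> 6\<close>, each factor 6 for one more power of
  \<open>W\<close>. The dominant term runs over two divisor loops, the search of length at most
  \<open>W ^ 6\<close> and the modular powers of cost at most \<open>W ^ 3\<close>.\<close>

lemma step_bound_le:
  assumes W: "C \<le> W" "L \<le> W" "Z \<le> W" "W \<ge> 6"
  shows "step_bound C L Z \<le> W ^ 13"
proof -
  have six: "6 * W ^ i \<le> W ^ Suc i" for i using W(4) by simp
  have pos: "W ^ i \<ge> 1" for i using W(4) by simp
  have "(2 * L) ^ 4 \<le> (2 * W) ^ 4" using W by (intro power_mono) auto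
  also have "\<dots> = 16 * W ^ 4" by simp
  also have "\<dots> \<le> W ^ 6" using six[of 4] six[of 5] by simp
  finally have B: "(2 * L) ^ 4 \<le> W ^ 6" .
  have quad: "x * (6 * x + 5) + 11 \<le> W ^ 4" if "x \<le> W" for x
  proof -
    have "x * (6 * x + 5) \<le> W * (6 * W + 5)" using that by (intro mult_le_mono) auto
    also have "\<dots> = 6 * W ^ 2 + 5 * W ^ 1" by (simp add: power2_eq_square algebra_simps)
    finally show ?thesis using six[of 1] six[of 2] six[of 3] pos[of 1] by (simp add: eval_nat_numeral)
  qed
  have L: "15 * L + 19 \<le> W ^ 3"
  proof -
    have "6 * W \<le> W ^ 2" using W(4) by (simp add: power2_eq_square)
    moreover have "6 * W ^ 2 \<le> W ^ 3" using six[of 2] by (simp only: Suc_numeral Num.add_num_simps)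
    ultimately show ?thesis using W by linarith
  qed
  have "(2 * L) ^ 4 * (15 * L + 19) \<le> W ^ 6 * W ^ 3" using B L by (rule mult_le_mono)
  then have "(2 * L) ^ 4 * (15 * L + 19) \<le> W ^ 9" by (simp flip: power_add)
  then have "(2 * L) ^ 4 * (15 * L + 19) + 9 \<le> W ^ 10"
    using six[of 9] six[of 8] pos[of 8] by simp
  then have "C * ((2 * L) ^ 4 * (15 * L + 19) + 9) \<le> W * W ^ 10" using W(1) by (intro mult_le_mono)
  then have a: "C * ((2 * L) ^ 4 * (15 * L + 19) + 9) \<le> W ^ 11" by (simp flip: power_Suc)
  have "W ^ 4 \<le> W ^ 11" using W(4) by (intro power_increasing) auto
  then have quad': "x * (6 * x + 5) + 11 \<le> W ^ 11" if "x \<le> W" for x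
    using quad[OF that] by linarith
  have "C * (3 * C + 5) \<le> C * (6 * C + 5)" by (intro mult_le_mono2) simp
  then have b: "C * (3 * C + 5) + 5 \<le> W ^ 11" using quad'[OF W(1)] by linarith
  have lin: "5 * x \<le> x * (6 * x + 5)" for x :: nat by (simp add: algebra_simps)
  have c: "3 * L + 6 \<le> W ^ 11" using quad'[OF W(2)] lin[of L] by linarith
  have d: "5 * Z + 3 \<le> W ^ 11" using quad'[OF W(3)] lin[of Z] by linarith
  have "C * (C * ((2 * L) ^ 4 * (15 * L + 19) + 9) + Z * (6 * Z + 5) + 11) \<le> W * (2 * W ^ 11)"
    using W(1) a quad'[OF W(3)] by (intro mult_le_mono) auto
  also have "\<dots> = 2 * W ^ 12" by (simp flip: power_Suc)
  finally show ?thesis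
    using b c d six[of 11] six[of 12] pos[of 11] unfolding step_bound_def by simp
qed

theorem theorem1:
  "\<exists>(prog :: com) (C :: nat). \<forall>(n :: nat) (fs :: (nat \<times> nat) list).
     n \<ge> 2 \<longrightarrow> is_prime_factorisation n fs \<longrightarrow>
     (\<exists>(T :: nat) (final :: state).
        exec prog (input_state fs) T final \<and>
        distinct (output_list final) \<and> set (output_list final) = Psi n \<and>
        real T \<le> (real (card (Psi_star n)) + real (tau n) + ln (real n)) ^ C)"
proof (rule exI, rule exI, intro allI impI)
  fix n :: nat and fs :: "(nat \<times> nat) list"
  assume n: "2 \<le> n" and fs: "is_prime_factorisation n fs"
  define W where "W = card (Psi_star n) + tau n + floorlog 2 n"
  define X where "X = real (card (Psi_star n)) + real (tau n) + ln (real n)"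
  have ge: "tau n \<ge> 2" "card (Psi_star n) \<ge> 2"
    using divisor_count_ge_2[OF n] card_Psi_star_ge_2[OF n] .
  have "floorlog 2 2 \<le> floorlog 2 n" using n by (rule floorlog_mono)
  moreover have "floorlog 2 2 = 2" by (simp add: compute_floorlog)
  \<comment> \<open>Each of the three summands is at least 2: 1 and \<open>n\<close> divide
    \<open>n\<close>, 1 and 2 have totient 1, and \<open>n\<close> has at least two binary
    digits.\<close>
  ultimately have W6: "W \<ge> 6" using ge by (simp add: W_def)
  have M2: "memory_bound n \<ge> 2" by (simp add: memory_bound_def)
  obtain t k s' where r: "exec Psi_prog (input_state fs) t s'" "t \<le> k * unit_cost (memory_bound n)"
    "k \<le> step_bound (tau n) (floorlog 2 n) (card (Psi_star n))"
    "distinct (output_list s')" "set (output_list s') = Psi n"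
    using wpE[OF wp_Psi_prog[OF fs n] M2 bounded_input_state[OF fs n]] by metis
  have "k \<le> W ^ 13"
    using r(3) step_bound_le[of "tau n" W "floorlog 2 n" "card (Psi_star n)"] W6 by (simp add: W_def)
  \<comment> \<open>The number of units and the cost of one unit contribute the exponents 13 and
    7.\<close>
  then have "k * unit_cost (memory_bound n) \<le> W ^ 13 * W ^ 7"
    using unit_cost_le[OF n W_def W6] by (intro mult_mono) auto
  then have "t \<le> W ^ 20" using r(2) by (simp flip: power_add)
  then have "real t \<le> real (W ^ 20)" by (rule of_nat_mono)
  also have "\<dots> = real W ^ 20" by simp
  \<comment> \<open>Passing from binary length to the natural logarithm: it costs a factor 2, since
    \<open>ln 2 \<ge> 1 / 2\<close>, and an additive 1. Both are absorbed in
    \<open>W \<le> 2 * X \<le> X^2\<close>, as \<open>X \<ge> 2\<close>, which doubles the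
    exponent.\<close>
  also have "\<dots> \<le> (X\<^sup>2) ^ 20"
  proof (rule power_mono)
    have ln0: "ln (real n) \<ge> 0" using n by simp
    have "real (floorlog 2 n) \<le> log 2 (real n) + 1"
      using n by (simp add: floorlog_def)
    also have "log 2 (real n) \<le> 2 * ln (real n)"
    proof -
      have "ln (2::real) \<ge> 1 / 2" using ln_le_minus_one[of "1 / 2 :: real"] by (simp add: ln_div)
      then have "ln (real n) / ln 2 \<le> ln (real n) / (1 / 2)"
        using ln0 by (intro divide_left_mono) auto
      then show ?thesis by (simp add: log_def)
    qed
    finally have "real W \<le> 2 * X" using ge by (simp add: W_def X_def)
    also have "\<dots> \<le> X * X" using ge ln0 by (intro mult_right_mono) (auto simp: X_def)
    finally show "real W \<le> X\<^sup>2" by (simp add: power2_eq_square)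
  qed simp
  also have "\<dots> = X ^ 40" by (simp flip: power_mult)
  finally have "real t \<le> X ^ 40" .
  then show "\<exists>T final. exec Psi_prog (input_state fs) T final \<and>
      distinct (output_list final) \<and> set (output_list final) = Psi n \<and>
      real T \<le> (real (card (Psi_star n)) + real (tau n) + ln (real n)) ^ 40"
    using r unfolding X_def by blast
qed

end
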